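(* Let $X\in RC$ and let $X=\prod_{i=1}^\infty N(a^{(i)}_1,\dots,a^{(i)}_n)$ be the ASW factorization of $X$. Then for every integer $k\ge1$ and every $i$, $$a_i^{(k)}=\lim_{h\to\infty}\frac{\Delta_{I^k_{i-1},J^k_h}(X)}{\Delta_{I^k_i,J^k_h}(X)}\Big/\lim_{h\to\infty}\frac{\Delta_{I^{k-1}_i,J^{k-1}_h}(X)}{\Delta_{I^{k-1}_{i+1},J^{k-1}_h}(X)},$$ where $I^k_i=\{i+1,i+2,\dots,i+k\}$ and $J^k_h=\{h+1,h+2,\dots,h+k\}$.
   Context: Fix $n\ge1$. All matrices are doubly infinite real matrices $X=(x_{i,j})_{i,j\in\mathbb{Z}}$ with $x_{i+n,j+n}=x_{i,j}$, upper triangular with $1$'s on the diagonal; $\Delta_{I,J}(X)$ is the minor with row set $I$ and column set $J$ (equal to $1$ when $I=J=\emptyset$). The whirl $M(a_1,\dots,a_n)$ has $m_{i,i}=1$, $m_{i,i+1}=a_i$ (index modulo $n$), other entries $0$. The curl $N(a_1,\dots,a_n)$ has $1$'s on the diagonal, $(i,j)$ entry $a_ia_{i+1}\cdots a_{j-1}$ for $i<j$ (indices modulo $n$), and $0$ below the diagonal; it is the inverse of $M(-a_1,\dots,-a_n)$. Limits of matrices are entrywise and $\prod_{i=1}^\infty X^{(i)}=\lim_{m\to\infty}X^{(1)}\cdots X^{(m)}$. $RC$ is the set of matrices $\prod_{i=1}^\infty N(b^{(i)}_1,\dots,b^{(i)}_n)$ with all $b^{(i)}_j>0$ and $\sum_{i,j}b^{(i)}_j<\infty$.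 ASW factorization of $X\in RC$: set $X_1=X$ and, inductively for $m\ge1$, $a^{(m)}_j=\epsilon_j(X_m):=\lim_{l\to\infty}(X_m)_{j,l}/(X_m)_{j+1,l}$ and $X_{m+1}=M(-a^{(m)}_1,\dots,-a^{(m)}_n)X_m$, so $X_m=N(a^{(m)}_1,\dots,a^{(m)}_n)X_{m+1}$. The resulting expression $X=\prod_{i=1}^\infty N(a^{(i)}_1,\dots,a^{(i)}_n)$ is the ASW factorization. Lower indices of $a^{(k)}_i$ are read modulo $n$. *)

theory Defs
  imports "HOL-Analysis.Infinite_Sum" "Jordan_Normal_Form.Determinant"
begin

type_synonym zmat = "int \<Rightarrow> int \<Rightarrow> real"

definition zmat_one :: zmat where
  "zmat_one i j = (if i = j then 1 else 0)"

text \<open>For upper triangular factors only the indices from \<open>i\<close> to \<open>j\<close> contribute to the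
  \<open>(i, j)\<close> entry of the product, so the finite sum below is the full matrix product.
  All products formed here are of upper triangular matrices.\<close>

definition zmat_mult :: "zmat \<Rightarrow> zmat \<Rightarrow> zmat" where
  "zmat_mult X Y i j = (\<Sum>k\<in>{i..j}. X i k * Y k j)"

text \<open>Products of families \<open>F 1, F 2, \<dots>\<close>; the value \<open>F 0\<close> is not used.\<close>

primrec zmat_prod :: "(nat \<Rightarrow> zmat) \<Rightarrow> nat \<Rightarrow> zmat" where
  "zmat_prod F 0 = zmat_one"
| "zmat_prod F (Suc m) = zmat_mult (zmat_prod F m) (F (Suc m))"

definition has_zmat_infprod :: "(nat \<Rightarrow> zmat) \<Rightarrow> zmat \<Rightarrow> bool" where
  "has_zmat_infprod F X \<longleftrightarrow> (\<forall>i j. (\<lambda>m. zmat_prod F m i j) \<longlonglongrightarrow> X i j)"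

text \<open>A tuple \<open>a\<^sub>1, \<dots>, a\<^sub>n\<close> is a function of which only the values on \<open>{1..n}\<close> matter;
  \<open>modidx n i\<close> is the representative of \<open>i\<close> modulo \<open>n\<close> in \<open>{1..n}\<close>.\<close>

definition modidx :: "nat \<Rightarrow> int \<Rightarrow> int" where
  "modidx n i = (i - 1) mod int n + 1"

definition whirl :: "nat \<Rightarrow> (int \<Rightarrow> real) \<Rightarrow> zmat" where
  "whirl n a i j = (if j = i then 1 else if j = i + 1 then a (modidx n i) else 0)"

definition curl :: "nat \<Rightarrow> (int \<Rightarrow> real) \<Rightarrow> zmat" where
  "curl n a i j = (if i \<le> j then \<Prod>t\<in>{i..<j}. a (modidx n t) else 0)"

definition RC :: "nat \<Rightarrow> zmat set" where
  "RC n = {X. \<exists>b :: nat \<Rightarrow> int \<Rightarrow> real.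
      (\<forall>m\<ge>1. \<forall>j\<in>{1..int n}. b m j > 0) \<and>
      (\<lambda>(m, j). b m j) summable_on ({1..} \<times> {1..int n}) \<and>
      has_zmat_infprod (\<lambda>m. curl n (b m)) X}"

definition asw_eps :: "zmat \<Rightarrow> int \<Rightarrow> real" where
  "asw_eps X j = Lim at_top (\<lambda>l::int. X j l / X (j + 1) l)"

text \<open>Recursion starts at 0, so \<open>asw_matrix n X m\<close> is the matrix \<open>X\<^sub>m\<^sub>+\<^sub>1\<close> of the
  ASW factorization. The parameters \<open>asw_param n X m j\<close> are meant for \<open>m \<ge> 1\<close>.\<close>

primrec asw_matrix :: "nat \<Rightarrow> zmat \<Rightarrow> nat \<Rightarrow> zmat" where
  "asw_matrix n X 0 = X"
| "asw_matrix n X (Suc m) =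
     zmat_mult (whirl n (\<lambda>j. - asw_eps (asw_matrix n X m) j)) (asw_matrix n X m)"

definition asw_param :: "nat \<Rightarrow> zmat \<Rightarrow> nat \<Rightarrow> int \<Rightarrow> real" where
  "asw_param n X m j = asw_eps (asw_matrix n X (m - 1)) (modidx n j)"

text \<open>The minor with row set \<open>I\<close> and column set \<open>J\<close>, for finite sets of equal cardinality,
  rows and columns taken in increasing order.\<close>

definition zminor :: "int set \<Rightarrow> int set \<Rightarrow> zmat \<Rightarrow> real" where
  "zminor I J X = det (mat (card I) (card J)
     (\<lambda>(r, c). X (sorted_list_of_set I ! r) (sorted_list_of_set J ! c)))"

text \<open>Both index sets \<open>I\<^sup>k\<^sub>i\<close> and \<open>J\<^sup>k\<^sub>h\<close> are of this form.\<close>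

definition seg :: "nat \<Rightarrow> int \<Rightarrow> int set" where
  "seg k i = {i + 1..i + int k}"

end

theory Submission imports Defs begin

text \<open>Call a minor solid if its rows are consecutive, and let \<open>R\<^sub>k\<^sub>,\<^sub>i(J)\<close> be the ratio of the solid
\<open>k \<times> k\<close> minors in the columns \<open>J\<close> with rows \<open>i, \<dots>, i + k - 1\<close> and \<open>i + 1, \<dots>, i + k\<close>. The
theorem says that the limits \<open>L\<^sub>k\<^sub>,\<^sub>i\<close> of \<open>R\<^sub>k\<^sub>,\<^sub>i\<close> along intervals \<open>J\<close> that move to the right exist,
are nonzero, and satisfy \<open>L\<^sub>k\<^sub>,\<^sub>i = a\<^sub>i\<^sup>(\<^sup>k\<^sup>) L\<^sub>k\<^sub>-\<^sub>1\<^sub>,\<^sub>i\<^sub>+\<^sub>1\<close>.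

The limits exist and are positive because \<open>R\<^sub>k\<^sub>,\<^sub>i\<close> is antitone far to the right and bounded below
by a positive constant. Antitonicity: if one column \<open>p\<close> of \<open>J\<close> is replaced by a column \<open>q\<close> to the right of all of \<open>J\<close>, the Desnanot-Jacobi identity
(\<open>dodgson_condensation\<close>) writes the cross-multiplied difference of the two ratios as a product of
two solid minors, and these are nonnegative.

Let \<open>Y\<close> be the matrix left after the first curl has been split off. Row \<open>j\<close> of \<open>X\<close> is row \<open>j\<close> of
\<open>Y\<close> plus \<open>\<epsilon>\<^sub>j\<close> times row \<open>j + 1\<close> of \<open>X\<close>, so in a solid minor of \<open>X\<close> all rows except the last may
be exchanged for rows of \<open>Y\<close>. By the choice of \<open>\<epsilon>\<close> the rows of \<open>Y\<close> are negligible compared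
with those of \<open>X\<close> far to the right. Hence a solid \<open>(k + 1) \<times> (k + 1)\<close> minor of \<open>X\<close> with columns
\<open>J \<union> {l}\<close>, divided by the entry of its last row in column \<open>l\<close>, tends to the solid \<open>k \<times> k\<close> minor
of \<open>Y\<close> with columns \<open>J\<close> as \<open>l \<longlongrightarrow> \<infinity>\<close> (\<open>asw_step_minor_limit\<close>). Taking ratios and squeezing
\<open>J \<union> {l}\<close> between intervals by antitonicity gives
\<open>L\<^sub>k\<^sub>+\<^sub>1\<^sub>,\<^sub>i(X) = \<epsilon>\<^sub>i\<^sub>+\<^sub>k(X) L\<^sub>k\<^sub>,\<^sub>i(Y)\<close> (\<open>minor_ratio_limit_step\<close>). Since the later parameters of \<open>X\<close> are
the parameters of \<open>Y\<close>, the claim follows by induction on \<open>k\<close>.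

The induction replaces \<open>X\<close> by \<open>Y\<close>, so it runs over a class of matrices that contains \<open>RC\<close> and is
closed under this step: the locale \<open>solid_positive\<close>, which asks for nonnegative solid minors,
positive solid minors far to the right, and a positive lower bound on \<open>R\<^sub>k\<^sub>,\<^sub>i\<close>. That \<open>Y\<close> inherits these
conditions from \<open>X\<close> follows from the same limit formula; for strict positivity the normalised
minors must stay away from \<open>0\<close>, which again comes from condensation (\<open>last_column_growth\<close>). For
matrices in \<open>RC\<close> the conditions are proved for finite products of curls, with bounds that do not
depend on the number of factors, by peeling off curls from the left.\<close>

section \<open>Determinants given by lists of rows and columns\<close>

type_synonym row = "int \<Rightarrow> real"

text \<open>Rows are functions on all columns and the columns are a separate list, so that rows can be exchanged
without touching the choice of columns and conversely.\<close>

definition rdet :: "row list \<Rightarrow> int list \<Rightarrow> real" where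
  "rdet rs cs = det (mat (length rs) (length rs) (\<lambda>(r, c). (rs ! r) (cs ! c)))"

text \<open>Adjacent equal rows are the only coincidence that the row operations below produce. The
notion is abstract because it is applied to minors with a fixed block of leading rows and to
differences of two such minors.\<close>

definition alternating :: "(row list \<Rightarrow> real) \<Rightarrow> bool" where
  "alternating \<Phi> \<longleftrightarrow>
     (\<forall>ps v c w qs. \<Phi> (ps @ (\<lambda>l. v l + c * w l) # qs) = \<Phi> (ps @ v # qs) + c * \<Phi> (ps @ w # qs)) \<and>
     (\<forall>ps v qs. \<Phi> (ps @ v # v # qs) = 0)"

lemma alternating_add:
  "alternating \<Phi> \<Longrightarrow> \<Phi> (ps @ (\<lambda>l. v l + c * w l) # qs) = \<Phi> (ps @ v # qs) + c * \<Phi> (ps @ w # qs)"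
  by (auto simp: alternating_def)

lemma alternating_dup: "alternating \<Phi> \<Longrightarrow> \<Phi> (ps @ v # v # qs) = 0"
  by (auto simp: alternating_def)

lemma alternating_prefix:
  assumes "alternating \<Phi>" shows "alternating (\<lambda>vs. \<Phi> (us @ vs))"
  unfolding alternating_def
  using alternating_add[OF assms, of "us @ _"] alternating_dup[OF assms, of "us @ _"] by simp

lemma alternating_diff:
  assumes "alternating \<Phi>" "alternating \<Psi>" shows "alternating (\<lambda>vs. \<Phi> vs - c * \<Psi> vs)"
  unfolding alternating_def
  using alternating_add[OF assms(1)] alternating_dup[OF assms(1)]
    alternating_add[OF assms(2)] alternating_dup[OF assms(2)] by (simp add: algebra_simps)

lemma rdet_alternating: "alternating (\<lambda>rs. rdet rs cs)"
  unfolding alternating_def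
proof (intro conjI allI)
  fix ps :: "row list" and v w :: row and c :: real and qs :: "row list"
  define n where "n = length ps + 1 + length qs"
  define M where "M x = mat n n (\<lambda>(r, c). ((ps @ x # qs) ! r) (cs ! c))" for x :: row
  have cof: "cofactor (M x) (length ps) j = cofactor (M y) (length ps) j" if "j < n" for x y j
  proof -
    have "mat_delete (M x) (length ps) j = mat_delete (M y) (length ps) j"
      unfolding mat_delete_def M_def
      by (rule eq_matI) (auto simp: nth_append nth_Cons' n_def)
    then show ?thesis by (simp add: cofactor_def)
  qed
  have exp: "rdet (ps @ x # qs) cs = (\<Sum>j<n. x (cs ! j) * cofactor (M v) (length ps) j)" for x
  proof -
    have "rdet (ps @ x # qs) cs = det (M x)" by (simp add: rdet_def M_def n_def)
    also have "\<dots> = (\<Sum>j<n. M x $$ (length ps, j) * cofactor (M x) (length ps) j)"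
      by (rule laplace_expansion_row) (auto simp: M_def n_def)
    also have "\<dots> = (\<Sum>j<n. x (cs ! j) * cofactor (M v) (length ps) j)"
      using cof[of _ x v] by (intro sum.cong refl) (auto simp: M_def n_def)
    finally show ?thesis .
  qed
  show "rdet (ps @ (\<lambda>l. v l + c * w l) # qs) cs = rdet (ps @ v # qs) cs + c * rdet (ps @ w # qs) cs"
    unfolding exp by (simp add: algebra_simps sum.distrib sum_distrib_left)
next
  fix ps :: "row list" and v :: row and qs :: "row list"
  show "rdet (ps @ v # v # qs) cs = 0" unfolding rdet_def
    by (rule det_identical_rows[of _ "length ps + 2 + length qs" "length ps" "length ps + 1"])
       (auto intro!: eq_vecI simp: nth_append)
qed

lemma rdet_cong:
  assumes "length rs = length rs'" "length cs = length rs" "length cs' = length rs"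
    and "\<And>r c. r < length rs \<Longrightarrow> c < length rs \<Longrightarrow> (rs ! r) (cs ! c) = (rs' ! r) (cs' ! c)"
  shows "rdet rs cs = rdet rs' cs'"
  unfolding rdet_def using assms by (intro arg_cong[of _ _ det] eq_matI) auto

lemma rdet_last_row:
  assumes "length cs = Suc (length us)"
  shows "rdet (us @ [y]) cs =
    (\<Sum>j\<le>length us. y (cs ! j) * (-1) ^ (length us + j) * rdet us (take j cs @ drop (Suc j) cs))"
proof -
  define n where "n = length us"
  define M where "M = mat (Suc n) (Suc n) (\<lambda>(r, c). ((us @ [y]) ! r) (cs ! c))"
  have "rdet (us @ [y]) cs = det M" by (simp add: rdet_def M_def n_def)
  also have "\<dots> = (\<Sum>j<Suc n. M $$ (n, j) * cofactor M n j)"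
    by (rule laplace_expansion_row) (auto simp: M_def n_def)
  also have "\<dots> = (\<Sum>j<Suc n. y (cs ! j) * (-1) ^ (n + j) * rdet us (take j cs @ drop (Suc j) cs))"
  proof (intro sum.cong refl)
    fix j assume "j \<in> {..<Suc n}"
    then have j: "j < Suc n" by simp
    have "mat_delete M n j = mat n n (\<lambda>(r, c). (us ! r) ((take j cs @ drop (Suc j) cs) ! c))"
      unfolding mat_delete_def M_def
      using j assms by (intro eq_matI) (auto simp: nth_append n_def min_def)
    then show "M $$ (n, j) * cofactor M n j =
        y (cs ! j) * (-1) ^ (n + j) * rdet us (take j cs @ drop (Suc j) cs)"
      using j by (simp add: cofactor_def rdet_def n_def M_def)
  qed
  finally show ?thesis unfolding n_def lessThan_Suc_atMost .
qed

text \<open>The coefficients \<open>C\<close> are cofactors of the last column, hence independent of the column index \<open>l\<close>.\<close>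

lemma rdet_last_column:
  assumes "length cs = length us"
  obtains C where "\<And>x l. rdet (us @ [x]) (cs @ [l]) = (\<Sum>r<length us. (us ! r) l * C x r) + x l * rdet us cs"
proof -
  define n where "n = length us"
  define M where "M x l = mat (Suc n) (Suc n) (\<lambda>(r, c). ((us @ [x]) ! r) ((cs @ [l]) ! c))" for x :: row and l
  have cof: "cofactor (M x l) r n = cofactor (M x 0) r n" for x l r
  proof -
    have "mat_delete (M x l) r n = mat_delete (M x 0) r n"
      unfolding mat_delete_def M_def using assms by (intro eq_matI) (auto simp: nth_append n_def)
    then show ?thesis by (simp add: cofactor_def)
  qed
  have last: "cofactor (M x l) n n = rdet us cs" for x l
  proof -
    have "mat_delete (M x l) n n = mat n n (\<lambda>(r, c). (us ! r) (cs ! c))"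
      unfolding mat_delete_def M_def using assms by (intro eq_matI) (auto simp: nth_append n_def)
    then show ?thesis by (simp add: cofactor_def rdet_def n_def)
  qed
  have "rdet (us @ [x]) (cs @ [l]) = (\<Sum>r<length us. (us ! r) l * cofactor (M x 0) r n) + x l * rdet us cs" for x l
  proof -
    have "rdet (us @ [x]) (cs @ [l]) = det (M x l)" by (simp add: rdet_def M_def n_def)
    also have "\<dots> = (\<Sum>r<Suc n. M x l $$ (r, n) * cofactor (M x l) r n)"
      by (rule laplace_expansion_column) (auto simp: M_def n_def)
    also have "\<dots> = (\<Sum>r<n. M x l $$ (r, n) * cofactor (M x l) r n) + x l * rdet us cs"
      using assms by (simp add: last) (simp add: M_def n_def nth_append)
    also have "(\<Sum>r<n. M x l $$ (r, n) * cofactor (M x l) r n) = (\<Sum>r<n. (us ! r) l * cofactor (M x 0) r n)"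
      by (intro sum.cong refl) (subst cof, use assms in \<open>auto simp: M_def n_def nth_append\<close>)
    finally show ?thesis by (simp add: n_def)
  qed
  then show thesis by (rule that)
qed

lemma nth_beside_middle:
  assumes "j < length (P @ p # Q)" "j \<noteq> length P"
  shows "(P @ p # Q) ! j \<in> set (P @ Q)"
  using assms by (cases "j < length P") (auto simp: nth_append nth_Cons')

lemma rdet_last_row_two_entries:
  assumes len: "length us = length (P @ Q) + 1" and z: "\<forall>s\<in>set (P @ Q). y s = 0"
  shows "rdet (us @ [y]) (P @ p # Q @ [q]) =
     y q * rdet us (P @ p # Q) + (-1) ^ (length Q + 1) * y p * rdet us (P @ Q @ [q])"
proof -
  let ?cs = "P @ p # Q @ [q]" and ?m = "length P" and ?n = "length us"
  let ?f = "\<lambda>j. y (?cs ! j) * (-1) ^ (?n + j) * rdet us (take j ?cs @ drop (Suc j) ?cs)"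
  have "rdet (us @ [y]) ?cs = (\<Sum>j\<le>?n. ?f j)"
    by (rule rdet_last_row) (use len in simp)
  also have "\<dots> = (\<Sum>j\<in>{?m, ?n}. ?f j)"
  proof (rule sum.mono_neutral_right)
    show "\<forall>j\<in>{..?n} - {?m, ?n}. ?f j = 0"
    proof
      fix j assume j: "j \<in> {..?n} - {?m, ?n}"
      have "?cs ! j = (P @ p # Q) ! j" using j len by (auto simp: nth_append nth_Cons')
      then have "?cs ! j \<in> set (P @ Q)" using nth_beside_middle[of j P p Q] j len by auto
      then show "?f j = 0" using z by simp
    qed
  qed (use len in auto)
  also have "\<dots> = ?f ?m + ?f ?n" using len by simp
  also have "?f ?n = y q * rdet us (P @ p # Q)"
    using len by (simp add: nth_append)
  also have "?f ?m = (-1) ^ (length Q + 1) * y p * rdet us (P @ Q @ [q])"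
    using len by (simp add: nth_append power_add mult.assoc[symmetric])
  finally show ?thesis by simp
qed

lemma rdet_last_row_one_entry:
  assumes len: "length us = length (P @ Q)" and z: "\<forall>s\<in>set (P @ Q). y s = 0"
  shows "rdet (us @ [y]) (P @ p # Q) = (-1) ^ length Q * y p * rdet us (P @ Q)"
proof -
  let ?cs = "P @ p # Q" and ?m = "length P" and ?n = "length us"
  let ?f = "\<lambda>j. y (?cs ! j) * (-1) ^ (?n + j) * rdet us (take j ?cs @ drop (Suc j) ?cs)"
  have "rdet (us @ [y]) ?cs = (\<Sum>j\<le>?n. ?f j)"
    by (rule rdet_last_row) (use len in simp)
  also have "\<dots> = (\<Sum>j\<in>{?m}. ?f j)"
  proof (rule sum.mono_neutral_right)
    show "\<forall>j\<in>{..?n} - {?m}. ?f j = 0"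
    proof
      fix j assume j: "j \<in> {..?n} - {?m}"
      have "?cs ! j \<in> set (P @ Q)" using nth_beside_middle[of j P p Q] j len by auto
      then show "?f j = 0" using z by simp
    qed
  qed (use len in auto)
  also have "\<dots> = (-1) ^ length Q * y p * rdet us (P @ Q)"
    using len by (simp add: nth_append power_add mult.assoc[symmetric])
  finally show ?thesis by simp
qed

text \<open>An invertible block \<open>vs\<close> can cancel the entries of any further row in the columns \<open>cs\<close>; the
coefficients come from the adjugate matrix.\<close>

lemma eliminate_row:
  assumes len: "length cs = length vs" and nz: "rdet vs cs \<noteq> 0"
  obtains \<alpha> where "\<forall>s\<in>set cs. w s + (\<Sum>i<length vs. \<alpha> i * (vs ! i) s) = 0"
proof -
  define n where "n = length vs"
  define V where "V = mat n n (\<lambda>(r, c). (vs ! r) (cs ! c))"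
  have V: "V \<in> carrier_mat n n" by (simp add: V_def)
  have d: "det V \<noteq> 0" using nz by (simp add: rdet_def V_def n_def)
  note adj = adj_mat[OF V]
  define \<alpha> where "\<alpha> i = - (\<Sum>c<n. w (cs ! c) * adj_mat V $$ (c, i)) / det V" for i
  have "w (cs ! s) + (\<Sum>i<n. \<alpha> i * (vs ! i) (cs ! s)) = 0" if s: "s < n" for s
  proof -
    have e: "(\<Sum>i<n. adj_mat V $$ (c, i) * (vs ! i) (cs ! s)) = (if c = s then det V else 0)"
      if c: "c < n" for c
    proof -
      have "(adj_mat V * V) $$ (c, s) = (\<Sum>i<n. adj_mat V $$ (c, i) * (vs ! i) (cs ! s))"
        using c s V adj(1) by (simp add: scalar_prod_def V_def atLeast0LessThan)
      then show ?thesis using c s unfolding adj(3) by (cases "c = s") simp_all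
    qed
    have "(\<Sum>i<n. \<alpha> i * (vs ! i) (cs ! s)) =
        - (\<Sum>i<n. (\<Sum>c<n. w (cs ! c) * adj_mat V $$ (c, i)) * (vs ! i) (cs ! s)) / det V"
      unfolding \<alpha>_def by (simp add: sum_divide_distrib[symmetric] sum_negf)
    also have "(\<Sum>i<n. (\<Sum>c<n. w (cs ! c) * adj_mat V $$ (c, i)) * (vs ! i) (cs ! s)) =
        (\<Sum>c<n. w (cs ! c) * (\<Sum>i<n. adj_mat V $$ (c, i) * (vs ! i) (cs ! s)))"
      by (simp add: sum_distrib_right sum_distrib_left mult.assoc) (rule sum.swap)
    also have "\<dots> = (\<Sum>c<n. if c = s then w (cs ! s) * det V else 0)"
      by (intro sum.cong refl) (auto simp: e)
    also have "\<dots> = w (cs ! s) * det V" using s by simp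
    finally show ?thesis using d by simp
  qed
  then show thesis using len by (intro that[of \<alpha>]) (auto simp: in_set_conv_nth n_def)
qed

lemma rdet_last_dup:
  assumes "v \<in> set vs" shows "rdet (vs @ [v]) cs = 0"
proof -
  obtain i where i: "i < length vs" "vs ! i = v" using assms by (auto simp: in_set_conv_nth)
  show ?thesis unfolding rdet_def
    by (rule det_identical_rows[of _ "Suc (length vs)" i "length vs"])
       (use i in \<open>auto intro!: eq_vecI simp: nth_append\<close>)
qed

lemma rdet_last_row_eliminate:
  assumes "set vs \<subseteq> set us"
  shows "rdet (us @ [\<lambda>l. w l + (\<Sum>i<length vs. \<alpha> i * (vs ! i) l)]) cs = rdet (us @ [w]) cs"
proof -
  have "rdet (us @ [\<lambda>l. w l + (\<Sum>i<m. \<alpha> i * (vs ! i) l)]) cs = rdet (us @ [w]) cs"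
    if "m \<le> length vs" for m
    using that
  proof (induction m)
    case (Suc m)
    have "rdet (us @ [\<lambda>l. w l + (\<Sum>i<Suc m. \<alpha> i * (vs ! i) l)]) cs =
      rdet (us @ [\<lambda>l. (w l + (\<Sum>i<m. \<alpha> i * (vs ! i) l)) + \<alpha> m * (vs ! m) l]) cs"
      by (simp add: add.assoc)
    also have "\<dots> = rdet (us @ [w]) cs + \<alpha> m * rdet (us @ [vs ! m]) cs"
      using Suc by (subst alternating_add[OF rdet_alternating]) simp
    also have "rdet (us @ [vs ! m]) cs = 0"
      by (rule rdet_last_dup) (use Suc.prems assms nth_mem[of m vs] in auto)
    finally show ?case by simp
  qed simp
  then show ?thesis by simp
qed

text \<open>The Desnanot-Jacobi identity, with the column \<open>p\<close> in arbitrary position. Neither side changes when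
multiples of the rows \<open>vs\<close> are added to \<open>w\<close>, and since the minor on \<open>vs\<close> is nonzero this makes \<open>w\<close>
vanish on all columns except \<open>p\<close> and \<open>q\<close>. Expansion along \<open>w\<close> then leaves at most two terms
in each determinant.\<close>

lemma dodgson_condensation:
  assumes len: "length vs = length (P @ Q)" and nz: "rdet vs (P @ Q) \<noteq> 0"
  shows "rdet (u # vs @ [w]) (P @ p # Q @ [q]) * rdet vs (P @ Q) =
     rdet (u # vs) (P @ p # Q) * rdet (vs @ [w]) (P @ Q @ [q])
     - rdet (u # vs) (P @ Q @ [q]) * rdet (vs @ [w]) (P @ p # Q)"
proof -
  obtain \<alpha> where \<alpha>: "\<forall>s\<in>set (P @ Q). w s + (\<Sum>i<length vs. \<alpha> i * (vs ! i) s) = 0"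
    using eliminate_row[of "P @ Q" vs w] len nz by metis
  define y where "y = (\<lambda>l. w l + (\<Sum>i<length vs. \<alpha> i * (vs ! i) l))"
  have z: "\<forall>s\<in>set (P @ Q). y s = 0" using \<alpha> by (simp add: y_def)
  have y1: "rdet ((u # vs) @ [w]) cs = rdet ((u # vs) @ [y]) cs" for cs
    unfolding y_def by (rule rdet_last_row_eliminate[symmetric]) auto
  have y2: "rdet (vs @ [w]) cs = rdet (vs @ [y]) cs" for cs
    unfolding y_def by (rule rdet_last_row_eliminate[symmetric]) auto
  have e1: "rdet (u # vs @ [w]) (P @ p # Q @ [q]) =
     y q * rdet (u # vs) (P @ p # Q) + (-1) ^ (length Q + 1) * y p * rdet (u # vs) (P @ Q @ [q])"
    using y1 rdet_last_row_two_entries[of "u # vs" P Q y p q] len z by simp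
  have e2: "rdet (vs @ [w]) (P @ p # Q) = (-1) ^ length Q * y p * rdet vs (P @ Q)"
    using y2 rdet_last_row_one_entry[of vs P Q y p] len z by simp
  have e3: "rdet (vs @ [w]) (P @ Q @ [q]) = y q * rdet vs (P @ Q)"
    using y2 rdet_last_row_one_entry[of vs "P @ Q" "[]" y q] len z by simp
  show ?thesis unfolding e1 e2 e3 by (simp add: algebra_simps)
qed

lemma rdet_zero_row:
  assumes len: "length cs = length ps + 1 + length qs" and z: "\<forall>c\<in>set cs. v c = 0"
  shows "rdet (ps @ v # qs) cs = 0"
proof -
  have "rdet (ps @ v # qs) cs = rdet (ps @ (\<lambda>l. 0) # qs) cs"
    using len z by (intro rdet_cong) (auto simp: nth_append nth_Cons')
  moreover have "rdet (ps @ (\<lambda>l. 0) # qs) cs = 2 * rdet (ps @ (\<lambda>l. 0) # qs) cs"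
    using alternating_add[OF rdet_alternating, where v = "\<lambda>l. 0" and w = "\<lambda>l. 0" and c = 1] by simp
  ultimately show ?thesis by simp
qed

section \<open>Splitting off a curl\<close>

text \<open>This is the row form of \<open>X = N(b) Z\<close> for upper triangular matrices: the entries of \<open>N(b)\<close> satisfy
\<open>N(b)\<^sub>j\<^sub>,\<^sub>k = b\<^sub>j N(b)\<^sub>j\<^sub>+\<^sub>1\<^sub>,\<^sub>k\<close> for \<open>k > j\<close>. It serves both the factors \<open>b\<^sup>(\<^sup>i\<^sup>)\<close> of a product of curls
and the steps of the ASW factorization.\<close>

definition curl_step :: "row \<Rightarrow> zmat \<Rightarrow> zmat \<Rightarrow> bool" where
  "curl_step b X Z \<longleftrightarrow> (\<forall>j. X j = (\<lambda>l. Z j l + b j * X (j + 1) l))"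

lemma curl_step_expand:
  assumes "alternating \<Phi>" "curl_step b X Z"
  shows "\<Phi> (ps @ X j # qs) = \<Phi> (ps @ Z j # qs) + b j * \<Phi> (ps @ X (j + 1) # qs)"
  using alternating_add[OF assms(1)] assms(2) unfolding curl_step_def by metis

text \<open>The term \<open>b\<^sub>t X\<^sub>t\<^sub>+\<^sub>1\<close> of row \<open>t\<close> is cancelled by the next row, except in the last row.\<close>

lemma consecutive_rows:
  assumes "alternating \<Phi>" "curl_step b X Z" "i \<le> j"
  shows "\<Phi> (map X [i..j] @ qs) = \<Phi> (map Z [i..j - 1] @ X j # qs)"
  using assms(1,3)
proof (induction "nat (j - i)" arbitrary: i \<Phi>)
  case 0
  then show ?case by simp
next
  case (Suc m)
  then have ij: "i < j" by simp
  have e1: "[i..j] = i # [i + 1..j]" and e2: "[i + 1..j] = (i + 1) # [i + 2..j]"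
    and e3: "[i..j - 1] = i # [i + 1..j - 1]"
    using ij upto_rec1[of i j] upto_rec1[of "i + 1" j] upto_rec1[of i "j - 1"] by (simp_all add: add.assoc)
  have "\<Phi> (map X [i..j] @ qs) = \<Phi> (Z i # map X [i + 1..j] @ qs)
      + b i * \<Phi> ([] @ X (i + 1) # X (i + 1) # map X [i + 2..j] @ qs)"
    using curl_step_expand[OF Suc.prems(1) assms(2), of "[]" i "map X [i + 1..j] @ qs"]
    unfolding e1 by (simp add: e2)
  also have "\<dots> = \<Phi> ([Z i] @ map X [i + 1..j] @ qs)"
    unfolding alternating_dup[OF Suc.prems(1)] by simp
  also have "\<dots> = \<Phi> ([Z i] @ map Z [i + 1..j - 1] @ X j # qs)"
    by (rule Suc.hyps(1)[OF _ alternating_prefix[OF Suc.prems(1)]]) (use Suc.hyps(2) ij in auto)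
  finally show ?case unfolding e3 by simp
qed

text \<open>Expanding the rows \<open>X\<^sub>i = Z\<^sub>i + b\<^sub>i X\<^sub>i\<^sub>+\<^sub>1\<close> repeatedly writes \<open>\<Phi>\<close> on rows of \<open>X\<close> as a nonnegative
combination of values on strictly increasing rows of \<open>Z\<close>: an index that has run up to its successor
yields two equal rows, and one that has run past \<open>M\<close> yields zero. The
mixed form, with the rows \<open>T\<close> already converted, is what the induction requires. The
lower bound \<open>lo\<close> on the indices allows hypotheses that hold only for rows below a fixed block.\<close>

lemma curl_expansion_nonneg:
  assumes alt: "alternating \<Phi>" and step: "curl_step b X Z" and b: "\<And>j. 0 \<le> b j"
    and vanish: "\<And>ps j qs. j > M \<Longrightarrow> length ps + 1 + length qs = r \<Longrightarrow> \<Phi> (ps @ X j # qs) = 0"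
    and base: "\<And>T. sorted_wrt (<) T \<Longrightarrow> length T = r \<Longrightarrow> \<forall>t\<in>set T. lo \<le> t \<Longrightarrow> 0 \<le> \<Phi> (map Z T)"
    and "sorted_wrt (<) (T @ I)" "length (T @ I) = r" "\<forall>t\<in>set (T @ I). lo \<le> t"
  shows "0 \<le> \<Phi> (map Z T @ map X I)"
  using assms(6-8)
proof (induction I arbitrary: T)
  case Nil
  then show ?case using base by simp
next
  case (Cons i I)
  from Cons.prems show ?case
  proof (induction "nat (M + 1 - i)" arbitrary: i rule: less_induct)
    case less
    show ?case
    proof (cases "i > M")
      case True
      then show ?thesis using vanish[of i "map Z T" "map X I"] less.prems by simp
    next
      case False
      \<comment> \<open>the two summands of row \<open>i\<close>: converted to \<open>Z\<close>, or moved on to \<open>i + 1\<close>\<close>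
      have "0 \<le> \<Phi> (map Z (T @ [i]) @ map X I)"
        using Cons.IH[of "T @ [i]"] less.prems by simp
      moreover have "0 \<le> \<Phi> (map Z T @ X (i + 1) # map X I)"
      proof (cases "I = [] \<or> i + 1 < hd I")
        case True
        then have "sorted_wrt (<) (T @ (i + 1) # I)"
          using less.prems(1) by (cases I) (auto simp: sorted_wrt_append)
        then show ?thesis
          using less.hyps[of "i + 1"] less.prems False by auto
      next
        case F: False
        then obtain I' where "I = (i + 1) # I'"
          using less.prems(1) by (cases I) (auto simp: sorted_wrt_append)
        then show ?thesis using alternating_dup[OF alt] by simp
      qed
      ultimately show ?thesis
        using curl_step_expand[OF alt step, of "map Z T" i "map X I"] b[of i] by simp
    qed
  qed
qed

definition upper :: "zmat \<Rightarrow> bool" where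
  "upper X \<longleftrightarrow> (\<forall>i j. j < i \<longrightarrow> X i j = 0)"

definition tnn :: "zmat \<Rightarrow> bool" where
  "tnn X \<longleftrightarrow> (\<forall>I J. sorted_wrt (<) I \<longrightarrow> sorted_wrt (<) J \<longrightarrow> length I = length J \<longrightarrow> 0 \<le> rdet (map X I) J)"

lemma rdet_below_columns:
  assumes "upper X" "\<forall>c\<in>set cs. c < j" "length cs = length ps + 1 + length qs"
  shows "rdet (ps @ X j # qs) cs = 0"
  using assms by (intro rdet_zero_row) (auto simp: upper_def)

lemma mixed_minor_nonneg:
  assumes "upper X" "tnn Z" and step: "curl_step b X Z" and b: "\<And>j. 0 \<le> b j"
    and "sorted_wrt (<) (T @ I)" "sorted_wrt (<) cs" "length cs = length (T @ I)"
  shows "0 \<le> rdet (map Z T @ map X I) cs"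
proof (rule curl_expansion_nonneg[where r = "length cs" and lo = "Min (set (T @ I))"
      and M = "Max (insert 0 (set cs))", OF rdet_alternating step b])
  fix ps :: "row list" and j and qs :: "row list"
  assume "j > Max (insert 0 (set cs))" "length ps + 1 + length qs = length cs"
  then show "rdet (ps @ X j # qs) cs = 0"
    using assms by (intro rdet_below_columns) auto
qed (use assms in \<open>auto simp: tnn_def\<close>)

lemma tnn_curl_step:
  assumes "upper X" "tnn Z" "curl_step b X Z" "\<And>j. 0 \<le> b j"
  shows "tnn X"
  unfolding tnn_def using mixed_minor_nonneg[OF assms, of "[]"] by simp

lemma mixed_minor_next_row_nonneg:
  assumes "upper X" "tnn Z" and step: "curl_step b X Z" and b: "\<And>j. 0 \<le> b j"
    and "sorted_wrt (<) (T @ i # I)" "sorted_wrt (<) cs" "length cs = length (T @ i # I)"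
  shows "0 \<le> rdet (map Z T @ X (i + 1) # map X I) cs"
proof (cases "I = [] \<or> i + 1 < hd I")
  case True
  then have "sorted_wrt (<) (T @ (i + 1) # I)"
    using assms(5) by (cases I) (auto simp: sorted_wrt_append)
  then show ?thesis
    using mixed_minor_nonneg[OF assms(1-4), of T "(i + 1) # I" cs] assms(6,7) by simp
next
  case False
  then obtain I' where "I = (i + 1) # I'"
    using assms(5) by (cases I) (auto simp: sorted_wrt_append)
  then show ?thesis using alternating_dup[OF rdet_alternating, of "map Z T"] by simp
qed

lemma mixed_minor_ge_minor:
  assumes "upper X" "tnn Z" and step: "curl_step b X Z" and b: "\<And>j. 0 \<le> b j"
    and "sorted_wrt (<) (T @ I)" "sorted_wrt (<) cs" "length cs = length (T @ I)"
  shows "rdet (map Z (T @ I)) cs \<le> rdet (map Z T @ map X I) cs"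
  using assms(5-7)
proof (induction I arbitrary: T)
  case (Cons i I)
  have "rdet (map Z ((T @ [i]) @ I)) cs \<le> rdet (map Z (T @ [i]) @ map X I) cs"
    by (rule Cons.IH) (use Cons.prems in auto)
  moreover have "0 \<le> rdet (map Z T @ X (i + 1) # map X I) cs"
    using mixed_minor_next_row_nonneg[OF assms(1-4)] Cons.prems by blast
  ultimately show ?case
    using curl_step_expand[OF rdet_alternating step, of "map Z T" i "map X I" cs] mult_nonneg_nonneg[OF b[of i]]
    by (auto intro: order_trans add_increasing2)
qed simp

text \<open>A row of \<open>X\<close> may be moved from \<open>i\<close> to \<open>j\<close> at the cost of the \<open>(i, j)\<close> entry of the curl, since
the summands dropped on the way are nonnegative.\<close>

lemma mixed_minor_lower_row:
  assumes "upper X" "tnn Z" and step: "curl_step b X Z" and b: "\<And>j. 0 \<le> b j"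
    and "sorted_wrt (<) cs" "length cs = length (T @ j # I)"
    and "sorted_wrt (<) (T @ i # I)" "i \<le> j" "\<forall>t\<in>set I. j < t"
  shows "(\<Prod>t\<in>{i..<j}. b t) * rdet (map Z T @ X j # map X I) cs \<le> rdet (map Z T @ X i # map X I) cs"
  using assms(7,8)
proof (induction "nat (j - i)" arbitrary: i)
  case 0
  then show ?case by simp
next
  case (Suc m)
  then have ij: "i < j" by simp
  have s: "sorted_wrt (<) (T @ (i + 1) # I)"
    using Suc.prems assms(9) ij by (fastforce simp: sorted_wrt_append)
  have "0 \<le> rdet (map Z (T @ [i]) @ map X I) cs"
    using mixed_minor_nonneg[OF assms(1-4), of "T @ [i]" I cs] Suc.prems assms(5,6) by simp
  moreover have "b i * ((\<Prod>t\<in>{i + 1..<j}. b t) * rdet (map Z T @ X j # map X I) cs)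
      \<le> b i * rdet (map Z T @ X (i + 1) # map X I) cs"
    by (rule mult_left_mono[OF Suc.hyps(1) b]) (use Suc.hyps(2) ij s in auto)
  moreover have "{i..<j} = insert i {i + 1..<j}" using ij by auto
  ultimately show ?case
    using curl_step_expand[OF rdet_alternating step, of "map Z T" i "map X I" cs]
    by (simp add: mult.assoc)
qed

section \<open>Finite products of curls\<close>

lemma zmat_mult_assoc: "zmat_mult (zmat_mult X Y) Z = zmat_mult X (zmat_mult Y Z)"
proof (intro ext)
  fix i j
  have "zmat_mult (zmat_mult X Y) Z i j = (\<Sum>k\<in>{i..j}. \<Sum>l\<in>{i..k}. X i l * Y l k * Z k j)"
    by (simp add: zmat_mult_def sum_distrib_right)
  also have "\<dots> = (\<Sum>k\<in>{i..j}. \<Sum>l | l \<in> {i..j} \<and> l \<le> k. X i l * Y l k * Z k j)"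
    by (intro sum.cong refl) auto
  also have "\<dots> = (\<Sum>l\<in>{i..j}. \<Sum>k | k \<in> {i..j} \<and> l \<le> k. X i l * Y l k * Z k j)"
    by (rule sum.swap_restrict) auto
  also have "\<dots> = (\<Sum>l\<in>{i..j}. \<Sum>k\<in>{l..j}. X i l * Y l k * Z k j)"
    by (intro sum.cong refl) auto
  also have "\<dots> = zmat_mult X (zmat_mult Y Z) i j"
    by (simp add: zmat_mult_def sum_distrib_left mult.assoc)
  finally show "zmat_mult (zmat_mult X Y) Z i j = zmat_mult X (zmat_mult Y Z) i j" .
qed

lemma zmat_mult_one_left: "zmat_mult zmat_one X i j = (if i \<le> j then X i j else 0)"
proof -
  have "zmat_mult zmat_one X i j = (\<Sum>k\<in>{i..j}. if k = i then X i j else 0)"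
    unfolding zmat_mult_def by (intro sum.cong refl) (auto simp: zmat_one_def)
  then show ?thesis by simp
qed

lemma zmat_mult_one_right: "zmat_mult X zmat_one i j = (if i \<le> j then X i j else 0)"
proof -
  have "zmat_mult X zmat_one i j = (\<Sum>k\<in>{i..j}. if k = j then X i j else 0)"
    unfolding zmat_mult_def by (intro sum.cong refl) (auto simp: zmat_one_def)
  then show ?thesis by simp
qed

text \<open>Only multiplication by a curl on the left acts on rows in the way of \<open>curl_step\<close>, so the inductions on
the number of curls split off the leftmost factor.\<close>

lemma zmat_prod_Suc_left:
  "zmat_prod F (Suc m) = zmat_mult (F 1) (zmat_prod (\<lambda>k. F (Suc k)) m)"
proof (induction m)
  case 0
  show ?case by (intro ext) (simp add: zmat_mult_one_left zmat_mult_one_right)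
next
  case (Suc m)
  then show ?case by (simp add: zmat_mult_assoc)
qed

lemma upper_zmat_mult: "upper (zmat_mult X Y)"
  by (simp add: upper_def zmat_mult_def)

lemma upper_zmat_prod: "upper (zmat_prod F m)"
  by (cases m) (simp_all add: upper_zmat_mult, simp add: upper_def zmat_one_def)

lemma curl_step_mult_curl:
  assumes "upper Z"
  shows "curl_step (\<lambda>j. a (modidx n j)) (zmat_mult (curl n a) Z) Z"
  unfolding curl_step_def
proof (intro allI ext)
  fix i j
  show "zmat_mult (curl n a) Z i j = Z i j + a (modidx n i) * zmat_mult (curl n a) Z (i + 1) j"
  proof (cases "i \<le> j")
    case True
    then have s: "{i..j} = insert i {i + 1..j}" by auto
    have "(\<Sum>k\<in>{i + 1..j}. curl n a i k * Z k j)
        = (\<Sum>k\<in>{i + 1..j}. a (modidx n i) * (curl n a (i + 1) k * Z k j))"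
    proof (intro sum.cong refl)
      fix k assume k: "k \<in> {i + 1..j}"
      then have "{i..<k} = insert i {i + 1..<k}" by auto
      then show "curl n a i k * Z k j = a (modidx n i) * (curl n a (i + 1) k * Z k j)"
        using k by (simp add: curl_def)
    qed
    then show ?thesis unfolding zmat_mult_def s by (simp add: sum_distrib_left) (simp add: curl_def)
  next
    case False
    then show ?thesis using assms by (simp add: zmat_mult_def upper_def)
  qed
qed

abbreviation curl_prod :: "nat \<Rightarrow> (nat \<Rightarrow> int \<Rightarrow> real) \<Rightarrow> nat \<Rightarrow> zmat" where
  "curl_prod n b \<equiv> zmat_prod (\<lambda>m. curl n (b m))"

definition positive_params :: "nat \<Rightarrow> (nat \<Rightarrow> int \<Rightarrow> real) \<Rightarrow> bool" where
  "positive_params n b \<longleftrightarrow> (\<forall>m\<ge>1. \<forall>j. 0 < b m (modidx n j))"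

lemma positive_params_Suc: "positive_params n b \<Longrightarrow> positive_params n (\<lambda>m. b (Suc m))"
  by (simp add: positive_params_def)

lemma curl_step_curl_prod:
  "curl_step (\<lambda>j. b 1 (modidx n j)) (curl_prod n b (Suc m)) (curl_prod n (\<lambda>m. b (Suc m)) m)"
  unfolding zmat_prod_Suc_left by (rule curl_step_mult_curl[OF upper_zmat_prod])

lemma curl_prod_diag: "curl_prod n b m i i = 1"
proof (induction m arbitrary: b i)
  case 0
  then show ?case by (simp add: zmat_one_def)
next
  case (Suc m)
  have "curl_prod n b (Suc m) i i =
    curl_prod n (\<lambda>m. b (Suc m)) m i i + b 1 (modidx n i) * curl_prod n b (Suc m) (i + 1) i"
    using curl_step_curl_prod[of b n m] unfolding curl_step_def by metis
  moreover have "curl_prod n b (Suc m) (i + 1) i = 0"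
    using upper_zmat_prod[of "\<lambda>m. curl n (b m)" "Suc m", unfolded upper_def] by (simp del: zmat_prod.simps)
  ultimately show ?case using Suc by simp
qed

lemma rdet_unitriangular:
  assumes "upper X" "\<And>i. X i i = 1" "sorted_wrt (<) cs"
  shows "rdet (map X cs) cs = 1"
proof -
  let ?A = "mat (length cs) (length cs) (\<lambda>(r, c). (map X cs ! r) (cs ! c))"
  have "upper_triangular ?A"
    using assms by (auto simp: upper_triangular_def upper_def sorted_wrt_iff_nth_less)
  then have "det ?A = prod_list (diag_mat ?A)"
    by (rule det_upper_triangular[of _ "length cs"]) simp
  also have "diag_mat ?A = map (\<lambda>_. 1) [0..<length cs]"
    using assms by (simp add: diag_mat_def cong: map_cong)
  also have "prod_list \<dots> = 1" by (simp add: map_replicate_const)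
  finally show ?thesis by (simp add: rdet_def)
qed

lemma tnn_one: "tnn zmat_one"
  unfolding tnn_def
proof (intro allI impI)
  fix I J :: "int list"
  assume I: "sorted_wrt (<) I" and J: "sorted_wrt (<) J" and len: "length I = length J"
  show "0 \<le> rdet (map zmat_one I) J"
  proof (cases "set I \<subseteq> set J")
    case True
    have "distinct I" "distinct J" using I J by (simp_all add: strict_sorted_iff)
    then have "set I = set J"
      using True len by (intro card_subset_eq) (simp_all add: distinct_card)
    then have "I = J" using I J by (simp add: strict_sorted_equal)
    then have "rdet (map zmat_one I) J = 1"
      using rdet_unitriangular[of zmat_one J] J by (simp add: upper_def zmat_one_def)
    then show ?thesis by simp
  next
    case False
    then obtain t where t: "t \<in> set I" "t \<notin> set J" by auto
    then obtain ps qs where "I = ps @ t # qs" by (meson split_list)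
    moreover have "\<forall>c\<in>set J. zmat_one t c = 0"
      using t(2) by (auto simp: zmat_one_def)
    ultimately have "rdet (map zmat_one I) J = 0"
      using len rdet_zero_row[of J "map zmat_one ps" "map zmat_one qs" "zmat_one t"] by simp
    then show ?thesis by simp
  qed
qed

lemma tnn_curl_prod: "positive_params n b \<Longrightarrow> tnn (curl_prod n b m)"
proof (induction m arbitrary: b)
  case 0
  then show ?case by (simp add: tnn_one)
next
  case (Suc m)
  show ?case
    by (rule tnn_curl_step[OF upper_zmat_prod Suc.IH[OF positive_params_Suc[OF Suc.prems]]
          curl_step_curl_prod]) (use Suc.prems in \<open>auto simp: positive_params_def intro: less_imp_le\<close>)
qed

text \<open>The bound has to be uniform in the number \<open>m\<close> of curls in order to survive the limit. The
first curl moves the lowest of the consecutive rows to the last column of \<open>C\<close>, the second curl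
does the same for the next row, and so on; after \<open>length C\<close> curls rows and columns agree and the
minor of the remaining product is \<open>1\<close>, whatever the number of remaining factors. The
columns \<open>U\<close> are those already reached.\<close>

lemma curl_prod_minor_bounded_below:
  assumes "positive_params n b" "sorted_wrt (<) (C @ U)" "\<forall>c\<in>set (C @ U). i + int (length C) \<le> c"
  shows "\<exists>w>0. \<forall>m\<ge>length C. w \<le> rdet (map (curl_prod n b m) ([i + 1..i + int (length C)] @ U)) (C @ U)"
  using assms
proof (induction C arbitrary: b U rule: rev_induct)
  case Nil
  have "rdet (map (curl_prod n b m) U) U = 1" for m
    by (rule rdet_unitriangular) (use Nil upper_zmat_prod curl_prod_diag in auto)
  then show ?case by (intro exI[of _ 1]) simp
next
  case (snoc c C)
  let ?b = "\<lambda>m. b (Suc m)" and ?k = "length C"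
  obtain w where w: "w > 0" "\<And>m. m \<ge> ?k \<Longrightarrow>
      w \<le> rdet (map (curl_prod n ?b m) ([i + 1..i + int ?k] @ c # U)) (C @ c # U)"
  proof -
    have 1: "sorted_wrt (<) (C @ c # U)" using snoc.prems(2) by simp
    have 2: "\<forall>x\<in>set (C @ c # U). i + int ?k \<le> x"
    proof
      fix x assume "x \<in> set (C @ c # U)"
      then have "i + int (length (C @ [c])) \<le> x" by (intro bspec[OF snoc.prems(3)]) auto
      then show "i + int ?k \<le> x" by simp
    qed
    from snoc.IH[OF positive_params_Suc[OF snoc.prems(1)] 1 2] show ?thesis
      using that by meson
  qed
  define p where "p = (\<Prod>t\<in>{i + int ?k + 1..<c}. b 1 (modidx n t))"
  have p: "p > 0" unfolding p_def
    by (rule prod_pos) (use snoc.prems(1) in \<open>auto simp: positive_params_def\<close>)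
  have "p * w \<le> rdet (map (curl_prod n b m) ([i + 1..i + int (length (C @ [c]))] @ U)) ((C @ [c]) @ U)"
    if m: "m \<ge> length (C @ [c])" for m
  proof -
    obtain m' where m': "m = Suc m'" "m' \<ge> ?k" using m by (cases m) auto
    let ?X = "curl_prod n b m" and ?Z = "curl_prod n ?b m'" and ?R = "[i + 1..i + int ?k]"
    have step: "curl_step (\<lambda>j. b 1 (modidx n j)) ?X ?Z"
      unfolding m'(1) by (rule curl_step_curl_prod)
    have pos: "0 \<le> b 1 (modidx n j)" for j
      using snoc.prems(1) by (auto simp: positive_params_def intro: less_imp_le)
    note st = upper_zmat_prod[of "\<lambda>m. curl n (b m)" m] tnn_curl_prod[OF positive_params_Suc[OF snoc.prems(1)], of m'] step pos
    have s1: "sorted_wrt (<) (?R @ c # U)" "sorted_wrt (<) (?R @ (i + int ?k + 1) # U)"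
      using snoc.prems(2,3) by (fastforce simp: sorted_wrt_append)+
    have "p * w \<le> p * rdet (map ?Z (?R @ c # U)) (C @ c # U)"
      using p w(2)[OF m'(2)] by (intro mult_left_mono) auto
    also have "\<dots> \<le> p * rdet (map ?Z ?R @ map ?X (c # U)) (C @ c # U)"
      by (intro mult_left_mono mixed_minor_ge_minor[OF st]) (use p s1 snoc.prems(2) in auto)
    also have "\<dots> \<le> rdet (map ?Z ?R @ ?X (i + int ?k + 1) # map ?X U) (C @ c # U)"
      unfolding p_def list.map
      by (rule mixed_minor_lower_row[OF st]) (use snoc.prems s1 in \<open>auto simp: sorted_wrt_append\<close>)
    also have "\<dots> = rdet (map ?X [i + 1..i + int ?k + 1] @ map ?X U) (C @ c # U)"
      using consecutive_rows[OF rdet_alternating step, of "i + 1" "i + int ?k + 1" "map ?X U" "C @ c # U"] by simp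
    finally show ?thesis by (simp add: add.assoc add.commute[of 1])
  qed
  then show ?case using p w(1) by (intro exI[of _ "p * w"]) auto
qed

text \<open>Shifting \<open>r\<close> consecutive rows down by one loses at most a constant factor, which depends on the first
\<open>r\<close> curls only. When one curl is split off, the last row \<open>i + r - 1\<close> of the upper block can be moved down
to \<open>i + r\<close>, where it agrees with the last row of the lower block. Then the induction hypothesis
applies to the other \<open>r - 1\<close> rows; this is why both minors carry further common rows \<open>T\<close>.\<close>

lemma curl_prod_minor_shift_rows:
  assumes "positive_params n b"
  shows "\<exists>c>0. \<forall>m\<ge>r. \<forall>T cs. sorted_wrt (<) T \<longrightarrow> sorted_wrt (<) cs \<longrightarrow> (\<forall>t\<in>set T. i + int r < t) \<longrightarrow>
      length cs = r + length T \<longrightarrow>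
      c * rdet (map (curl_prod n b m) ([i + 1..i + int r] @ T)) cs
        \<le> rdet (map (curl_prod n b m) ([i..i + int r - 1] @ T)) cs"
  using assms
proof (induction r arbitrary: b)
  case 0
  then show ?case by (intro exI[of _ 1]) simp
next
  case (Suc r)
  let ?b = "\<lambda>m. b (Suc m)" and ?\<beta> = "\<lambda>j. b 1 (modidx n j)"
  obtain c where c: "c > 0" and IH: "\<And>m T cs. m \<ge> r \<Longrightarrow> sorted_wrt (<) T \<Longrightarrow> sorted_wrt (<) cs \<Longrightarrow>
      \<forall>t\<in>set T. i + int r < t \<Longrightarrow> length cs = r + length T \<Longrightarrow>
      c * rdet (map (curl_prod n ?b m) ([i + 1..i + int r] @ T)) cs
        \<le> rdet (map (curl_prod n ?b m) ([i..i + int r - 1] @ T)) cs"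
    using Suc.IH[OF positive_params_Suc[OF Suc.prems]] by meson
  have pos: "0 < ?\<beta> j" for j
    using Suc.prems by (auto simp: positive_params_def)
  have "?\<beta> (i + int r) * c * rdet (map (curl_prod n b m) ([i + 1..i + int (Suc r)] @ T)) cs
        \<le> rdet (map (curl_prod n b m) ([i..i + int (Suc r) - 1] @ T)) cs"
    if m: "m \<ge> Suc r" and T: "sorted_wrt (<) T" "\<forall>t\<in>set T. i + int (Suc r) < t"
      and cs: "sorted_wrt (<) cs" "length cs = Suc r + length T" for m T cs
  proof -
    obtain m' where m': "m = Suc m'" "m' \<ge> r" using m by (cases m) auto
    let ?X = "curl_prod n b m" and ?Z = "curl_prod n ?b m'"
    let ?R = "map ?Z [i..i + int r - 1]" and ?R' = "map ?Z [i + 1..i + int r]"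
    have step: "curl_step ?\<beta> ?X ?Z" unfolding m'(1) by (rule curl_step_curl_prod)
    note st = upper_zmat_prod[of "\<lambda>m. curl n (b m)" m] tnn_curl_prod[OF positive_params_Suc[OF Suc.prems], of m'] step less_imp_le[OF pos]
    \<comment> \<open>the induction hypothesis is about rows of \<open>?Z\<close>; expanding \<open>\<Phi>\<close> transfers it to rows of \<open>?X\<close>\<close>
    define \<Phi> where "\<Phi> vs = rdet (?R @ vs) cs - c * rdet (?R' @ vs) cs" for vs
    have alt: "alternating \<Phi>" unfolding \<Phi>_def
      by (intro alternating_diff alternating_prefix[where \<Phi> = "\<lambda>rs. rdet rs cs"] rdet_alternating)
    have "0 \<le> \<Phi> (map ?Z [] @ map ?X ((i + int r + 1) # T))"
    proof (rule curl_expansion_nonneg[where r = "Suc (length T)" and lo = "i + int r + 1"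
          and M = "Max (insert 0 (set cs))", OF alt step less_imp_le[OF pos]])
      fix ps :: "row list" and j and qs :: "row list"
      assume "j > Max (insert 0 (set cs))" "length ps + 1 + length qs = Suc (length T)"
      then have "rdet ((?R @ ps) @ ?X j # qs) cs = 0" "rdet ((?R' @ ps) @ ?X j # qs) cs = 0"
        using cs(2) by (intro rdet_below_columns upper_zmat_prod; auto)+
      then show "\<Phi> (ps @ ?X j # qs) = 0" by (simp add: \<Phi>_def)
    next
      fix T' :: "int list" assume "sorted_wrt (<) T'" "length T' = Suc (length T)" "\<forall>t\<in>set T'. i + int r + 1 \<le> t"
      then show "0 \<le> \<Phi> (map ?Z T')"
        using IH[OF m'(2), of T' cs] cs by (fastforce simp: \<Phi>_def)
    qed (use T in \<open>auto simp: less_imp_le\<close>)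
    then have 1: "c * rdet (?R' @ ?X (i + int r + 1) # map ?X T) cs \<le> rdet (?R @ ?X (i + int r + 1) # map ?X T) cs"
      by (simp add: \<Phi>_def)
    have R: "[i..i + int r] = [i..i + int r - 1] @ [i + int r]"
      using upto_rec2[of i "i + int r"] by simp
    have "sorted_wrt (<) ([i..i + int r] @ T)"
      using T by (fastforce simp: sorted_wrt_append)
    then have "0 \<le> rdet (map ?Z [i..i + int r] @ map ?X T) cs"
      by (rule mixed_minor_nonneg[OF st]) (use cs in auto)
    then have 2: "0 \<le> rdet (?R @ ?Z (i + int r) # map ?X T) cs"
      unfolding R by simp
    have 3: "rdet (map ?X [i + 1..i + int r + 1] @ map ?X T) cs = rdet (?R' @ ?X (i + int r + 1) # map ?X T) cs"
      using consecutive_rows[OF rdet_alternating step, of "i + 1" "i + int r + 1" "map ?X T" cs] by simp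
    have 4: "rdet (map ?X [i..i + int r] @ map ?X T) cs =
       rdet (?R @ ?Z (i + int r) # map ?X T) cs + ?\<beta> (i + int r) * rdet (?R @ ?X (i + int r + 1) # map ?X T) cs"
      using consecutive_rows[OF rdet_alternating step, of i "i + int r" "map ?X T" cs]
        curl_step_expand[OF rdet_alternating step, of ?R "i + int r" "map ?X T" cs] by simp
    show ?thesis
      using 2 3 4 mult_left_mono[OF 1 less_imp_le[OF pos[of "i + int r"]]]
      by (simp add: add.assoc add.commute[of 1] mult.assoc)
  qed
  then show ?case using c pos by (intro exI[of _ "?\<beta> (i + int r) * c"]) auto
qed

section \<open>Solid minors and their ratios\<close>

definition solid_minor :: "zmat \<Rightarrow> nat \<Rightarrow> int \<Rightarrow> int list \<Rightarrow> real" where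
  "solid_minor X k i cs = rdet (map X [i + 1..i + int k]) cs"

definition minor_ratio :: "zmat \<Rightarrow> nat \<Rightarrow> int \<Rightarrow> int list \<Rightarrow> real" where
  "minor_ratio X k i cs = solid_minor X k (i - 1) cs / solid_minor X k i cs"

lemma zminor_seg: "zminor (seg k i) (seg k h) X = solid_minor X k i [h + 1..h + int k]"
proof -
  have l: "sorted_list_of_set {a..b} = [a..b]" for a b :: int
    by (rule sorted_list_of_set.finite_set_strict_sorted) auto
  show ?thesis
    unfolding zminor_def seg_def l solid_minor_def rdet_def
    by (intro arg_cong[of _ _ det] eq_matI) auto
qed

lemma solid_minor_0: "solid_minor X 0 i [] = 1"
  by (simp add: solid_minor_def rdet_def)

lemma solid_minor_1: "solid_minor X 1 i [c] = X (i + 1) c"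
  by (simp add: solid_minor_def rdet_def det_single)

text \<open>Condensation for the rows \<open>i, \<dots>, i + k\<close>: all six minors are solid.\<close>

lemma solid_minor_condensation:
  assumes "solid_minor X (length (P @ Q)) i (P @ Q) \<noteq> 0" and k: "k = Suc (length (P @ Q))"
  shows "solid_minor X (Suc k) (i - 1) (P @ p # Q @ [q]) * solid_minor X (length (P @ Q)) i (P @ Q) =
    solid_minor X k (i - 1) (P @ p # Q) * solid_minor X k i (P @ Q @ [q])
    - solid_minor X k (i - 1) (P @ Q @ [q]) * solid_minor X k i (P @ p # Q)"
proof -
  define vs where "vs = map X [i + 1..i + int (length (P @ Q))]"
  have r1: "map X [i - 1 + 1..i - 1 + int k] = X i # vs"
    using upto_rec1[of i "i - 1 + int k"] k by (simp add: vs_def)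
  have r2: "map X [i + 1..i + int k] = vs @ [X (i + int k)]"
    using upto_rec2[of "i + 1" "i + int k"] k by (simp add: vs_def)
  have r3: "map X [i - 1 + 1..i - 1 + int (Suc k)] = X i # vs @ [X (i + int k)]"
    using r2 upto_rec1[of i "i + int k"] by simp
  show ?thesis
    using dodgson_condensation[of vs P Q "X i" "X (i + int k)" p q] assms(1)
    unfolding solid_minor_def r1 r2 r3 by (simp add: vs_def)
qed

lemma filterlim_int_shift: "filterlim (\<lambda>h::int. h + c) at_top at_top"
  unfolding filterlim_at_top eventually_at_top_linorder
proof
  fix Z show "\<exists>N. \<forall>h\<ge>N. Z \<le> h + c" by (intro exI[of _ "Z - c"]) auto
qed

lemma antitone_int_convergent:
  fixes f :: "int \<Rightarrow> real"
  assumes dec: "\<And>h. N \<le> h \<Longrightarrow> f (h + 1) \<le> f h" and lb: "\<And>h. N \<le> h \<Longrightarrow> c \<le> f h"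
  shows "\<exists>L\<ge>c. (f \<longlongrightarrow> L) at_top"
proof -
  have "decseq (\<lambda>m. f (N + int m))"
    by (rule decseq_SucI) (use dec[of "N + int _"] in \<open>simp add: add.assoc add.commute[of 1]\<close>)
  then obtain L where L: "(\<lambda>m. f (N + int m)) \<longlonglongrightarrow> L" "\<forall>i. L \<le> f (N + int i)"
    using lb by (elim decseq_convergent[of _ c]) auto
  have "filterlim (\<lambda>h::int. nat (h - N)) at_top at_top"
    unfolding filterlim_at_top eventually_at_top_linorder
  proof
    fix Z show "\<exists>M. \<forall>h\<ge>M. Z \<le> nat (h - N)" by (intro exI[of _ "N + int Z"]) auto
  qed
  then have "((\<lambda>h. f (N + int (nat (h - N)))) \<longlongrightarrow> L) at_top"
    by (rule filterlim_compose[OF L(1)])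
  moreover have "\<forall>\<^sub>F h in at_top. f (N + int (nat (h - N))) = f h"
    using eventually_ge_at_top[of N] by eventually_elim simp
  ultimately have "(f \<longlongrightarrow> L) at_top" by (rule Lim_transform_eventually)
  moreover have "c \<le> L"
    by (rule LIMSEQ_le_const[OF L(1)]) (use lb in auto)
  ultimately show ?thesis by blast
qed

text \<open>The class on which the induction runs. The conditions speak of solid minors, since these are
the minors of the next matrix of the ASW factorization that are obtained as limits of minors of
\<open>X\<close>. Positivity is asked for columns far to the right, as the bound on the columns may move with
each step. The last condition makes the limits of the ratios positive, hence also the parameters \<open>asw_eps X i\<close>.\<close>

locale solid_positive =
  fixes n :: nat and X :: zmat
  assumes periodic: "X (i + int n) (j + int n) = X i j"
    and upper: "upper X"
    and solid_minor_nonneg: "sorted_wrt (<) cs \<Longrightarrow> 0 \<le> solid_minor X (length cs) i cs"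
    and solid_minor_pos: "\<exists>N. \<forall>cs. sorted_wrt (<) cs \<longrightarrow> length cs = k \<longrightarrow> (\<forall>c\<in>set cs. N \<le> c)
          \<longrightarrow> 0 < solid_minor X k i cs"
    and shift_rows: "\<exists>c>0. \<forall>cs. sorted_wrt (<) cs \<longrightarrow> length cs = k
          \<longrightarrow> c * solid_minor X k i cs \<le> solid_minor X k (i - 1) cs"
begin

lemma eventually_solid_minor_pos:
  "\<forall>\<^sub>F N in at_top. \<forall>cs. sorted_wrt (<) cs \<longrightarrow> length cs = k \<longrightarrow> (\<forall>c\<in>set cs. N \<le> c)
          \<longrightarrow> 0 < solid_minor X k i cs"
proof -
  obtain N where "\<forall>cs. sorted_wrt (<) cs \<longrightarrow> length cs = k \<longrightarrow> (\<forall>c\<in>set cs. N \<le> c)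
          \<longrightarrow> 0 < solid_minor X k i cs" using solid_minor_pos by blast
  then show ?thesis unfolding eventually_at_top_linorder by (intro exI[of _ N]) force
qed

lemma minor_ratio_antimono:
  assumes "sorted_wrt (<) (P @ p # Q @ [q])" "k = Suc (length (P @ Q))"
    and "0 < solid_minor X (length (P @ Q)) i (P @ Q)"
    and "0 < solid_minor X k i (P @ p # Q)" "0 < solid_minor X k i (P @ Q @ [q])"
  shows "minor_ratio X k i (P @ Q @ [q]) \<le> minor_ratio X k i (P @ p # Q)"
proof -
  have "0 \<le> solid_minor X (Suc k) (i - 1) (P @ p # Q @ [q])"
    using solid_minor_nonneg[OF assms(1)] assms(2) by simp
  then have "solid_minor X k (i - 1) (P @ Q @ [q]) * solid_minor X k i (P @ p # Q)
      \<le> solid_minor X k (i - 1) (P @ p # Q) * solid_minor X k i (P @ Q @ [q])"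
    using solid_minor_condensation[of X P Q i k p q] assms(2,3)
    by (smt (verit) mult_nonneg_nonneg)
  then show ?thesis
    using assms(4,5) by (simp add: minor_ratio_def divide_simps mult.commute)
qed

lemma eventually_minor_ratio_antimono:
  "\<forall>\<^sub>F N in at_top. \<forall>P p Q q. sorted_wrt (<) (P @ p # Q @ [q]) \<longrightarrow> (\<forall>c\<in>set (P @ p # Q @ [q]). N \<le> c) \<longrightarrow>
     k = Suc (length (P @ Q)) \<longrightarrow> minor_ratio X k i (P @ Q @ [q]) \<le> minor_ratio X k i (P @ p # Q)"
  using eventually_solid_minor_pos[of k i] eventually_solid_minor_pos[of "k - 1" i]
proof eventually_elim
  case (elim N)
  show ?case
  proof (intro allI impI)
    fix P p Q q
    assume *: "sorted_wrt (<) (P @ p # Q @ [q])" "\<forall>c\<in>set (P @ p # Q @ [q]). N \<le> c" "k = Suc (length (P @ Q))"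
    show "minor_ratio X k i (P @ Q @ [q]) \<le> minor_ratio X k i (P @ p # Q)"
      by (rule minor_ratio_antimono[OF *(1,3)])
        (use * elim(1)[rule_format, of "P @ p # Q"] elim(1)[rule_format, of "P @ Q @ [q]"]
          elim(2)[rule_format, of "P @ Q"] in \<open>auto simp: sorted_wrt_append\<close>)
  qed
qed

text \<open>The interval \<open>[h + 1..h + k]\<close> becomes the next one by replacing its first column by a new last one.\<close>

lemma minor_ratio_convergent:
  "\<exists>L>0. ((\<lambda>h. minor_ratio X k i [h + 1..h + int k]) \<longlongrightarrow> L) at_top"
proof (cases k)
  case 0
  then show ?thesis
    by (intro exI[of _ 1]) (simp add: minor_ratio_def solid_minor_0)
next
  case (Suc m)
  obtain c where c: "c > 0" "\<And>cs. sorted_wrt (<) cs \<Longrightarrow> length cs = k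
          \<Longrightarrow> c * solid_minor X k i cs \<le> solid_minor X k (i - 1) cs"
    using shift_rows by blast
  obtain N where N: "\<And>P p Q q. sorted_wrt (<) (P @ p # Q @ [q]) \<Longrightarrow> (\<forall>c\<in>set (P @ p # Q @ [q]). N \<le> c) \<Longrightarrow>
     k = Suc (length (P @ Q)) \<Longrightarrow> minor_ratio X k i (P @ Q @ [q]) \<le> minor_ratio X k i (P @ p # Q)"
    and pos: "\<And>cs. sorted_wrt (<) cs \<Longrightarrow> length cs = k \<Longrightarrow> (\<forall>c\<in>set cs. N \<le> c)
          \<Longrightarrow> 0 < solid_minor X k i cs"
    using eventually_happens'[OF _ eventually_conj[OF eventually_minor_ratio_antimono[of k i] eventually_solid_minor_pos[of k i]]]
    by (metis trivial_limit_at_top_linorder)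
  have "minor_ratio X k i [h + 1 + 1..h + 1 + int k] \<le> minor_ratio X k i [h + 1..h + int k]" if "N \<le> h" for h
  proof -
    have e1: "[h + 1..h + int k] = [] @ (h + 1) # [h + 2..h + int k]"
      using upto_rec1[of "h + 1" "h + int k"] Suc by (simp add: add.assoc)
    have e2: "[h + 1 + 1..h + 1 + int k] = [] @ [h + 2..h + int k] @ [h + int k + 1]"
      using upto_rec2[of "h + 2" "h + 1 + int k"] Suc by (simp add: add.commute add.left_commute)
    show ?thesis unfolding e1 e2
      by (rule N) (use that Suc in \<open>auto simp: sorted_wrt_append\<close>)
  qed
  moreover have "c \<le> minor_ratio X k i [h + 1..h + int k]" if "N \<le> h" for h
    using pos[of "[h + 1..h + int k]"] c(2)[of "[h + 1..h + int k]"] that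
    by (auto simp: minor_ratio_def pos_le_divide_eq)
  ultimately obtain L where "L \<ge> c" "((\<lambda>h. minor_ratio X k i [h + 1..h + int k]) \<longlongrightarrow> L) at_top"
    using antitone_int_convergent[of N "\<lambda>h. minor_ratio X k i [h + 1..h + int k]" c] by blast
  then show ?thesis using c(1) by (intro exI[of _ L]) auto
qed

lemma eventually_entry_pos: "\<forall>\<^sub>F l in at_top. 0 < X i l"
  using eventually_solid_minor_pos[of 1 "i - 1"]
proof eventually_elim
  case (elim l)
  then have "0 < solid_minor X 1 (i - 1) [l]" by simp
  then show ?case unfolding solid_minor_1 by simp
qed

lemma entry_ratio: "((\<lambda>l. X i l / X (i + 1) l) \<longlongrightarrow> asw_eps X i) at_top"
  and asw_eps_pos: "0 < asw_eps X i"
proof -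
  obtain L where L: "L > 0" "((\<lambda>h. minor_ratio X 1 i [h + 1..h + int 1]) \<longlongrightarrow> L) at_top"
    using minor_ratio_convergent by blast
  have "((\<lambda>h. minor_ratio X 1 i [h + - 1 + 1..h + - 1 + int 1]) \<longlongrightarrow> L) at_top"
    by (rule filterlim_compose[OF L(2) filterlim_int_shift])
  then have lim: "((\<lambda>l. X i l / X (i + 1) l) \<longlongrightarrow> L) at_top"
    using solid_minor_1[of X "i - 1"] solid_minor_1[of X i] by (simp add: minor_ratio_def)
  then have "asw_eps X i = L"
    unfolding asw_eps_def by (intro tendsto_Lim) auto
  with lim L(1) show "((\<lambda>l. X i l / X (i + 1) l) \<longlongrightarrow> asw_eps X i) at_top" "0 < asw_eps X i"
    by simp_all
qed

lemma asw_eps_periodic: "asw_eps X (i + int n) = asw_eps X i"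
proof -
  have "((\<lambda>l. X (i + int n) (l + int n) / X (i + int n + 1) (l + int n)) \<longlongrightarrow> asw_eps X (i + int n)) at_top"
    by (rule filterlim_compose[OF entry_ratio filterlim_int_shift])
  moreover have "X (i + int n + 1) (l + int n) = X (i + 1) l" for l
    using periodic[of "i + 1" l] by (simp add: add.assoc add.commute[of 1])
  ultimately have "((\<lambda>l. X i l / X (i + 1) l) \<longlongrightarrow> asw_eps X (i + int n)) at_top"
    by (simp add: periodic)
  then show ?thesis by (rule tendsto_unique[OF _ _ entry_ratio, rotated]) simp
qed

text \<open>Whirls read their parameters modulo \<open>n\<close>, so that periodicity of \<open>asw_eps X\<close> is what makes each row of
\<open>X\<close> be reduced by its own parameter.\<close>

lemma asw_eps_modidx: "asw_eps X (modidx n i) = asw_eps X i"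
proof -
  have *: "asw_eps X (j + int m * int n) = asw_eps X j" for m j
  proof (induction m)
    case (Suc m)
    then show ?case using asw_eps_periodic[of "j + int m * int n"] by (simp add: algebra_simps)
  qed simp
  have q: "i = modidx n i + (i - 1) div int n * int n"
    by (simp add: modidx_def)
  show ?thesis
  proof (cases "0 \<le> (i - 1) div int n")
    case True
    then show ?thesis using *[of "modidx n i" "nat ((i - 1) div int n)"] q by simp
  next
    case False
    then have "asw_eps X (i + - ((i - 1) div int n) * int n) = asw_eps X i"
      using *[of i "nat (- ((i - 1) div int n))"] by simp
    moreover have "i + - ((i - 1) div int n) * int n = modidx n i" using q by linarith
    ultimately show ?thesis by simp
  qed
qed

lemma entry_ratio_convergent: "\<exists>L. ((\<lambda>l. X i l / X (i + int m) l) \<longlongrightarrow> L) at_top"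
proof (induction m)
  case 0
  have "\<forall>\<^sub>F l in at_top. 1 = X i l / X (i + int 0) l"
    using eventually_entry_pos[of i] by eventually_elim simp
  then show ?case by (intro exI[of _ 1]) (rule Lim_transform_eventually[OF tendsto_const])
next
  case (Suc m)
  then obtain L where "((\<lambda>l. X i l / X (i + int m) l) \<longlongrightarrow> L) at_top" by blast
  from tendsto_mult[OF this entry_ratio[of "i + int m"]]
  have "((\<lambda>l. X i l / X (i + int m) l * (X (i + int m) l / X (i + int m + 1) l)) \<longlongrightarrow> L * asw_eps X (i + int m)) at_top" .
  moreover have "\<forall>\<^sub>F l in at_top. X i l / X (i + int m) l * (X (i + int m) l / X (i + int m + 1) l) = X i l / X (i + int (Suc m)) l"
    using eventually_entry_pos[of "i + int m"] by eventually_elim (simp add: add.assoc add.commute[of 1])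
  ultimately show ?case
    by (intro exI[of _ "L * asw_eps X (i + int m)"]) (rule Lim_transform_eventually)
qed

end

section \<open>Matrices in RC\<close>

lemma modidx_periodic: "modidx n (t + int n) = modidx n t"
proof -
  have "(t + int n - 1) mod int n = (t - 1 + int n) mod int n" by (simp add: algebra_simps)
  then show ?thesis by (simp add: modidx_def)
qed

lemma zmat_mult_periodic:
  assumes "\<And>i j. X (i + int n) (j + int n) = X i j" "\<And>i j. Y (i + int n) (j + int n) = Y i j"
  shows "zmat_mult X Y (i + int n) (j + int n) = zmat_mult X Y i j"
  unfolding zmat_mult_def
  by (rule sum.reindex_bij_witness[where i = "\<lambda>k. k + int n" and j = "\<lambda>k. k - int n"])
     (use assms(1)[of i "_ - int n"] assms(2)[of "_ - int n" j] in auto)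

lemma curl_periodic: "curl n a (i + int n) (j + int n) = curl n a i j"
proof -
  have "(\<Prod>t\<in>{i + int n..<j + int n}. a (modidx n t)) = (\<Prod>t\<in>{i..<j}. a (modidx n t))"
    by (rule prod.reindex_bij_witness[where i = "\<lambda>k. k + int n" and j = "\<lambda>k. k - int n"])
       (use modidx_periodic[of n "_ - int n"] in auto)
  then show ?thesis by (simp add: curl_def)
qed

lemma whirl_periodic: "whirl n a (i + int n) (j + int n) = whirl n a i j"
  by (auto simp: whirl_def modidx_periodic)

lemma curl_prod_periodic: "curl_prod n b m (i + int n) (j + int n) = curl_prod n b m i j"
proof (induction m arbitrary: i j)
  case 0
  show ?case by (simp add: zmat_one_def)
next
  case (Suc m)
  show ?case unfolding zmat_prod.simps by (rule zmat_mult_periodic) (rule Suc.IH curl_periodic)+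
qed

lemma tendsto_rdet:
  assumes "\<And>i j. ((\<lambda>m. F m i j) \<longlongrightarrow> X i j) G"
  shows "((\<lambda>m. rdet (map (F m) I) J) \<longlongrightarrow> rdet (map X I) J) G"
proof -
  let ?n = "length I"
  have "rdet (map Y I) J = (\<Sum>p | p permutes {0..<?n}. signof p * (\<Prod>i = 0..<?n. Y (I ! i) (J ! p i)))" for Y
    unfolding rdet_def
    by (subst det_def'[of _ ?n]) (auto intro!: sum.cong prod.cong simp: permutes_in_image)
  then show ?thesis by (simp only:) (intro tendsto_intros assms)
qed

lemma RC_solid_positive:
  assumes "n \<ge> 1" "X \<in> RC n"
  shows "solid_positive n X"
proof -
  obtain b where b: "\<forall>m\<ge>1. \<forall>j\<in>{1..int n}. b m j > 0" and lim: "has_zmat_infprod (\<lambda>m. curl n (b m)) X"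
    using assms(2) unfolding RC_def by blast
  have pp: "positive_params n b" unfolding positive_params_def
  proof (intro allI impI)
    fix m :: nat and j assume "m \<ge> 1"
    moreover have "modidx n j \<in> {1..int n}"
      using assms(1) pos_mod_bound[of "int n" "j - 1"] pos_mod_sign[of "int n" "j - 1"]
      unfolding modidx_def atLeastAtMost_iff by linarith
    ultimately show "b m (modidx n j) > 0" using b by blast
  qed
  have ent: "(\<lambda>m. curl_prod n b m i j) \<longlonglongrightarrow> X i j" for i j
    using lim by (simp add: has_zmat_infprod_def)
  have minor: "(\<lambda>m. solid_minor (curl_prod n b m) k i cs) \<longlonglongrightarrow> solid_minor X k i cs" for k i cs
    unfolding solid_minor_def by (rule tendsto_rdet[OF ent])
  show ?thesis
  proof
    show "X (i + int n) (j + int n) = X i j" for i j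
      using ent[of "i + int n" "j + int n"] unfolding curl_prod_periodic by (rule LIMSEQ_unique[OF _ ent])
    show "upper X" unfolding upper_def
    proof (intro allI impI)
      fix i j :: int assume "j < i"
      then have "(\<lambda>m. 0) \<longlonglongrightarrow> X i j"
        using ent[of i j] upper_zmat_prod[unfolded upper_def] by simp
      then show "X i j = 0" by (simp add: LIMSEQ_const_iff)
    qed
    show "0 \<le> solid_minor X (length cs) i cs" if "sorted_wrt (<) cs" for i cs
    proof (rule LIMSEQ_le_const[OF minor])
      show "\<exists>N. \<forall>m\<ge>N. 0 \<le> solid_minor (curl_prod n b m) (length cs) i cs"
        using tnn_curl_prod[OF pp] that by (simp add: solid_minor_def tnn_def)
    qed
    show "\<exists>N. \<forall>cs. sorted_wrt (<) cs \<longrightarrow> length cs = k \<longrightarrow> (\<forall>c\<in>set cs. N \<le> c)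
          \<longrightarrow> 0 < solid_minor X k i cs" for k i
    proof (intro exI[of _ "i + int k"] allI impI)
      fix cs assume cs: "sorted_wrt (<) cs" "length cs = k" "\<forall>c\<in>set cs. i + int k \<le> c"
      obtain w where w: "w > 0" "\<And>m. m \<ge> k \<Longrightarrow> w \<le> solid_minor (curl_prod n b m) k i cs"
        using curl_prod_minor_bounded_below[OF pp, of cs "[]" i] cs by (auto simp: solid_minor_def)
      then have "w \<le> solid_minor X k i cs" by (intro LIMSEQ_le_const[OF minor]) auto
      then show "0 < solid_minor X k i cs" using w(1) by simp
    qed
    show "\<exists>c>0. \<forall>cs. sorted_wrt (<) cs \<longrightarrow> length cs = k
          \<longrightarrow> c * solid_minor X k i cs \<le> solid_minor X k (i - 1) cs" for k i
    proof -
      obtain c where c: "c > 0" and le: "\<And>m cs. m \<ge> k \<Longrightarrow> sorted_wrt (<) cs \<Longrightarrow> length cs = k \<Longrightarrow>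
          c * solid_minor (curl_prod n b m) k i cs \<le> solid_minor (curl_prod n b m) k (i - 1) cs"
        using curl_prod_minor_shift_rows[OF pp, of k i]
        by (fastforce simp: solid_minor_def algebra_simps dest: spec[of _ "[]"])
      show ?thesis
      proof (intro exI[of _ c] conjI allI impI c)
        fix cs :: "int list" assume "sorted_wrt (<) cs" "length cs = k"
        then show "c * solid_minor X k i cs \<le> solid_minor X k (i - 1) cs"
          by (intro LIMSEQ_le[OF tendsto_mult_left[OF minor] minor]) (use le in auto)
      qed
    qed
  qed
qed

section \<open>One step of the ASW factorization\<close>

abbreviation asw_step :: "nat \<Rightarrow> zmat \<Rightarrow> zmat" where
  "asw_step n X \<equiv> zmat_mult (whirl n (\<lambda>j. - asw_eps X j)) X"

context solid_positive
begin

lemma asw_step_row: "asw_step n X i j = X i j - asw_eps X i * X (i + 1) j"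
proof (cases "i < j")
  case True
  have "asw_step n X i j = (\<Sum>k\<in>{i, i + 1}. whirl n (\<lambda>j. - asw_eps X j) i k * X k j)"
    unfolding zmat_mult_def using True
    by (intro sum.mono_neutral_right) (auto simp: whirl_def)
  then show ?thesis by (simp add: whirl_def asw_eps_modidx)
next
  case False
  then show ?thesis using upper by (cases "i = j") (simp_all add: zmat_mult_def whirl_def upper_def)
qed

lemma curl_step_asw_step: "curl_step (asw_eps X) X (asw_step n X)"
  by (auto simp: curl_step_def asw_step_row)

lemma asw_step_row_negligible:
  assumes "i \<le> j"
  shows "((\<lambda>l. asw_step n X i l / X (j + 1) l) \<longlongrightarrow> 0) at_top"
proof -
  obtain m where m: "j = i + int m" using assms zle_iff_zadd by blast
  obtain L where L: "((\<lambda>l. X (i + 1) l / X (i + 1 + int m) l) \<longlongrightarrow> L) at_top"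
    using entry_ratio_convergent by blast
  have "((\<lambda>l. (X i l / X (i + 1) l - asw_eps X i) * (X (i + 1) l / X (i + 1 + int m) l)) \<longlongrightarrow> (asw_eps X i - asw_eps X i) * L) at_top"
    by (intro tendsto_intros entry_ratio L)
  moreover have "\<forall>\<^sub>F l in at_top. (X i l / X (i + 1) l - asw_eps X i) * (X (i + 1) l / X (i + 1 + int m) l)
      = asw_step n X i l / X (j + 1) l"
    using eventually_entry_pos[of "i + 1"]
    by eventually_elim (simp add: asw_step_row m left_diff_distrib diff_divide_distrib add_ac)
  ultimately show ?thesis using Lim_transform_eventually by fastforce
qed

text \<open>The rows of the minor may be taken from \<open>asw_step n X\<close>, except for the last one. Divided by
the last entry of the last column, that column tends to \<open>(0, \<dots>, 0, 1)\<close>.\<close>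

lemma asw_step_minor_limit:
  assumes "length cs = k"
  shows "((\<lambda>l. solid_minor X (Suc k) i (cs @ [l]) / X (i + int k + 1) l)
           \<longlongrightarrow> solid_minor (asw_step n X) k i cs) at_top"
proof -
  let ?us = "map (asw_step n X) [i + 1..i + int k]" and ?x = "X (i + int k + 1)"
  have e: "solid_minor X (Suc k) i (cs @ [l]) = rdet (?us @ [?x]) (cs @ [l])" for l
    using consecutive_rows[OF rdet_alternating curl_step_asw_step, of "i + 1" "i + int k + 1" "[]"]
    by (simp add: solid_minor_def add.assoc add.commute[of 1])
  obtain C where C: "\<And>x l. rdet (?us @ [x]) (cs @ [l]) =
      (\<Sum>r<length ?us. (?us ! r) l * C x r) + x l * rdet ?us cs"
    using rdet_last_column[of cs ?us] assms by auto
  have "((\<lambda>l. (\<Sum>r<k. asw_step n X (i + 1 + int r) l / ?x l * C ?x r) + rdet ?us cs)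
      \<longlongrightarrow> (\<Sum>r<k. 0 * C ?x r) + rdet ?us cs) at_top"
    by (intro tendsto_intros asw_step_row_negligible) auto
  moreover have "\<forall>\<^sub>F l in at_top. (\<Sum>r<k. asw_step n X (i + 1 + int r) l / ?x l * C ?x r) + rdet ?us cs
      = solid_minor X (Suc k) i (cs @ [l]) / ?x l"
    using eventually_entry_pos[of "i + int k + 1"]
  proof eventually_elim
    case (elim l)
    have "(\<Sum>r<length ?us. (?us ! r) l * C ?x r) = (\<Sum>r<k. asw_step n X (i + 1 + int r) l * C ?x r)"
      by (intro sum.cong) auto
    then show ?case using elim unfolding e C
      by (simp add: add_divide_distrib sum_divide_distrib)
  qed
  ultimately show ?thesis
    by (simp add: solid_minor_def Lim_transform_eventually)
qed

lemma eventually_int_list_less: "\<forall>\<^sub>F l::int in at_top. \<forall>c\<in>set cs. c < l"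
  by (simp add: eventually_ball_finite)

text \<open>This keeps the limit in \<open>asw_step_minor_limit\<close> away from \<open>0\<close>. Condensation with first column \<open>j\<close>
and last column \<open>l\<close> expresses the minor, up to a positive constant, as the minor without first
row and first column, to which induction applies, times the drop of \<open>minor_ratio\<close> when the
column \<open>j\<close> is replaced by \<open>l\<close>. That drop is positive for one \<open>l\<close>, and it
grows with \<open>l\<close> since the ratio is antitone.\<close>

lemma last_column_growth:
  "\<exists>N. \<forall>cs. sorted_wrt (<) cs \<longrightarrow> length cs = k \<longrightarrow> (\<forall>c\<in>set cs. N \<le> c) \<longrightarrow>
     (\<exists>c>0. \<forall>\<^sub>F l in at_top. c * X (i + int k + 1) l \<le> solid_minor X (Suc k) i (cs @ [l]))"
proof (induction k arbitrary: i)
  case 0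
  have "solid_minor X (Suc 0) i [l] = X (i + 1) l" for l using solid_minor_1 by simp
  then show ?case by (intro exI[of _ 0]) (auto intro!: exI[of _ 1])
next
  case (Suc k)
  obtain N1 where N1: "\<And>cs. sorted_wrt (<) cs \<Longrightarrow> length cs = k \<Longrightarrow> \<forall>c\<in>set cs. N1 \<le> c \<Longrightarrow>
     \<exists>c>0. \<forall>\<^sub>F l in at_top. c * X (i + 1 + int k + 1) l \<le> solid_minor X (Suc k) (i + 1) (cs @ [l])"
    using Suc[of "i + 1"] by blast
  obtain N2 where N2:
    "\<And>cs. sorted_wrt (<) cs \<Longrightarrow> length cs = k \<Longrightarrow> (\<forall>c\<in>set cs. N2 \<le> c) \<Longrightarrow> 0 < solid_minor X k (i + 1) cs"
    using solid_minor_pos by blast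
  obtain N3 where N3:
    "\<And>cs. sorted_wrt (<) cs \<Longrightarrow> length cs = Suc k \<Longrightarrow> (\<forall>c\<in>set cs. N3 \<le> c) \<Longrightarrow> 0 < solid_minor X (Suc k) (i + 1) cs"
    using solid_minor_pos by blast
  obtain N4 where N4:
    "\<And>cs. sorted_wrt (<) cs \<Longrightarrow> length cs = Suc (Suc k) \<Longrightarrow> (\<forall>c\<in>set cs. N4 \<le> c) \<Longrightarrow> 0 < solid_minor X (Suc (Suc k)) i cs"
    using solid_minor_pos by blast
  define N where "N = Max {N1, N2, N3, N4}"
  have N: "N1 \<le> N" "N2 \<le> N" "N3 \<le> N" "N4 \<le> N" by (simp_all add: N_def)
  show ?case
  proof (intro exI[of _ N] allI impI)
    fix cs0 assume cs0: "sorted_wrt (<) cs0" "length cs0 = Suc k" "\<forall>c\<in>set cs0. N \<le> c"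
    then obtain j cs where cs0_eq: "cs0 = j # cs" by (cases cs0) auto
    define l0 where "l0 = Max (set cs0) + 1"
    have l0: "c < l0" if "c \<in> set cs0" for c
      using that unfolding l0_def by (meson List.finite_set Max_ge less_add_one order_le_less_trans)
    have Nl0: "N \<le> l0" using l0[of j] cs0 cs0_eq by auto
    have bnd: "sorted_wrt (<) cs" "length cs = k" "\<forall>c\<in>set cs. N \<le> c" "\<forall>c\<in>set cs. j < c" "N \<le> j"
      using cs0 cs0_eq by auto
    let ?d = "solid_minor X k (i + 1) cs"
    let ?A = "\<lambda>t. solid_minor X (Suc k) i t" and ?B = "\<lambda>t. solid_minor X (Suc k) (i + 1) t"
    have d: "?d > 0" using N2[of cs] bnd N by force
    have Bj: "?B (j # cs) > 0" using N3[of "j # cs"] cs0 cs0_eq N by force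
    have Bl: "?B (cs @ [l]) > 0" if "l0 \<le> l" for l
      using N3[of "cs @ [l]"] bnd N l0 cs0_eq that Nl0 by (force simp: sorted_wrt_append)
    have cond: "solid_minor X (Suc (Suc k)) i (j # cs @ [l]) * ?d =
        ?A (j # cs) * ?B (cs @ [l]) - ?A (cs @ [l]) * ?B (j # cs)" for l
      using solid_minor_condensation[of X "[]" cs "i + 1" "Suc k" j l] d bnd(2) by simp
    have "0 < solid_minor X (Suc (Suc k)) i (j # cs @ [l0])"
      using N4[of "j # cs @ [l0]"] bnd N l0 cs0_eq Nl0 by (force simp: sorted_wrt_append)
    then have "0 < ?A (j # cs) * ?B (cs @ [l0]) - ?A (cs @ [l0]) * ?B (j # cs)"
      using cond[of l0] d by (metis mult_pos_pos)
    define g where "g = ?A (j # cs) - minor_ratio X (Suc k) (i + 1) (cs @ [l0]) * ?B (j # cs)"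
    have "g = (?A (j # cs) * ?B (cs @ [l0]) - ?A (cs @ [l0]) * ?B (j # cs)) / ?B (cs @ [l0])"
      using Bl[of l0] by (simp add: g_def minor_ratio_def field_simps)
    then have g: "g > 0"
      using \<open>0 < ?A (j # cs) * ?B (cs @ [l0]) - _\<close> Bl[of l0] by simp
    obtain c where c: "c > 0" "\<forall>\<^sub>F l in at_top. c * X (i + 1 + int k + 1) l \<le> ?B (cs @ [l])"
      using N1[of cs] bnd N by force
    have "\<forall>\<^sub>F l in at_top. c * g / ?d * X (i + int (Suc k) + 1) l \<le> solid_minor X (Suc (Suc k)) i (cs0 @ [l])"
      using c(2) eventually_gt_at_top[of l0]
    proof eventually_elim
      case (elim l)
      have "minor_ratio X (Suc k) (i + 1) (cs @ [l]) \<le> minor_ratio X (Suc k) (i + 1) (cs @ [l0])"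
        using minor_ratio_antimono[of cs l0 "[]" l "Suc k" "i + 1"] bnd d Bl[of l0] Bl[of l] elim(2) l0 cs0_eq
        by (force simp: sorted_wrt_append)
      then have "?A (cs @ [l]) \<le> minor_ratio X (Suc k) (i + 1) (cs @ [l0]) * ?B (cs @ [l])"
        using Bl[of l] elim(2) by (simp add: minor_ratio_def[of X "Suc k" "i + 1" "cs @ [l]"] pos_divide_le_eq)
      then have "?A (cs @ [l]) * ?B (j # cs) \<le> minor_ratio X (Suc k) (i + 1) (cs @ [l0]) * ?B (cs @ [l]) * ?B (j # cs)"
        using Bj by (intro mult_right_mono) auto
      then have "g * ?B (cs @ [l]) \<le> solid_minor X (Suc (Suc k)) i (j # cs @ [l]) * ?d"
        unfolding cond g_def by (simp add: algebra_simps)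
      moreover have "g * (c * X (i + 1 + int k + 1) l) \<le> g * ?B (cs @ [l])"
        using elim(1) g by (intro mult_left_mono) auto
      ultimately show ?case
        using d cs0_eq by (simp add: pos_divide_le_eq algebra_simps)
    qed
    then show "\<exists>c>0. \<forall>\<^sub>F l in at_top. c * X (i + int (Suc k) + 1) l \<le> solid_minor X (Suc (Suc k)) i (cs0 @ [l])"
      using c(1) g d by (intro exI[of _ "c * g / ?d"]) auto
  qed
qed

lemma minor_ratio_last_column_limit:
  assumes "length cs = k" "solid_minor (asw_step n X) k i cs \<noteq> 0"
  shows "((\<lambda>l. minor_ratio X (Suc k) i (cs @ [l])) \<longlongrightarrow> asw_eps X (i + int k) * minor_ratio (asw_step n X) k i cs) at_top"
proof -
  have "((\<lambda>l. X (i + int k) l / X (i + int k + 1) l *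
      ((solid_minor X (Suc k) (i - 1) (cs @ [l]) / X (i - 1 + int k + 1) l) /
       (solid_minor X (Suc k) i (cs @ [l]) / X (i + int k + 1) l)))
     \<longlongrightarrow> asw_eps X (i + int k) * minor_ratio (asw_step n X) k i cs) at_top"
    unfolding minor_ratio_def
    by (intro tendsto_intros entry_ratio asw_step_minor_limit assms)
  moreover have "\<forall>\<^sub>F l in at_top. X (i + int k) l / X (i + int k + 1) l *
      ((solid_minor X (Suc k) (i - 1) (cs @ [l]) / X (i - 1 + int k + 1) l) /
       (solid_minor X (Suc k) i (cs @ [l]) / X (i + int k + 1) l)) = minor_ratio X (Suc k) i (cs @ [l])"
    using eventually_entry_pos[of "i + int k"] eventually_entry_pos[of "i + int k + 1"]
    by eventually_elim (simp add: minor_ratio_def)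
  ultimately show ?thesis by (rule Lim_transform_eventually)
qed

lemma solid_positive_asw_step: "solid_positive n (asw_step n X)"
proof
  show "asw_step n X (i + int n) (j + int n) = asw_step n X i j" for i j
    by (rule zmat_mult_periodic) (rule whirl_periodic periodic)+
  show "upper (asw_step n X)" by (rule upper_zmat_mult)
  show "0 \<le> solid_minor (asw_step n X) (length cs) i cs" if cs: "sorted_wrt (<) cs" for i cs
  proof (rule tendsto_lowerbound[OF asw_step_minor_limit])
    show "\<forall>\<^sub>F l in at_top. 0 \<le> solid_minor X (Suc (length cs)) i (cs @ [l]) / X (i + int (length cs) + 1) l"
      using eventually_entry_pos[of "i + int (length cs) + 1"] eventually_int_list_less[of cs]
    proof eventually_elim
      case (elim l)
      then show ?case using solid_minor_nonneg[of "cs @ [l]" i] cs by (simp add: sorted_wrt_append)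
    qed
  qed auto
  show "\<exists>N. \<forall>cs. sorted_wrt (<) cs \<longrightarrow> length cs = k \<longrightarrow> (\<forall>c\<in>set cs. N \<le> c)
          \<longrightarrow> 0 < solid_minor (asw_step n X) k i cs" for k i
  proof -
    obtain N where N: "\<And>cs. sorted_wrt (<) cs \<Longrightarrow> length cs = k \<Longrightarrow> (\<forall>c\<in>set cs. N \<le> c) \<Longrightarrow>
     \<exists>c>0. \<forall>\<^sub>F l in at_top. c * X (i + int k + 1) l \<le> solid_minor X (Suc k) i (cs @ [l])"
      using last_column_growth by blast
    show ?thesis
    proof (intro exI[of _ N] allI impI)
      fix cs assume cs: "sorted_wrt (<) cs" "length cs = k" "\<forall>c\<in>set cs. N \<le> c"
      obtain c where c: "c > 0" "\<forall>\<^sub>F l in at_top. c * X (i + int k + 1) l \<le> solid_minor X (Suc k) i (cs @ [l])"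
        using N[OF cs] by blast
      have "c \<le> solid_minor (asw_step n X) k i cs"
      proof (rule tendsto_lowerbound[OF asw_step_minor_limit[OF cs(2)]])
        show "\<forall>\<^sub>F l in at_top. c \<le> solid_minor X (Suc k) i (cs @ [l]) / X (i + int k + 1) l"
          using c(2) eventually_entry_pos[of "i + int k + 1"]
          by eventually_elim (simp add: pos_le_divide_eq)
      qed simp
      then show "0 < solid_minor (asw_step n X) k i cs" using c(1) by simp
    qed
  qed
  show "\<exists>c>0. \<forall>cs. sorted_wrt (<) cs \<longrightarrow> length cs = k
          \<longrightarrow> c * solid_minor (asw_step n X) k i cs \<le> solid_minor (asw_step n X) k (i - 1) cs" for k i
  proof -
    obtain c where c: "c > 0" "\<And>cs. sorted_wrt (<) cs \<Longrightarrow> length cs = Suc k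
          \<Longrightarrow> c * solid_minor X (Suc k) i cs \<le> solid_minor X (Suc k) (i - 1) cs"
      using shift_rows by blast
    let ?e = "asw_eps X (i + int k)"
    have "c * solid_minor (asw_step n X) k i cs \<le> ?e * solid_minor (asw_step n X) k (i - 1) cs"
      if cs: "sorted_wrt (<) cs" "length cs = k" for cs
    proof (rule tendsto_le[OF _ _ tendsto_mult_left[OF asw_step_minor_limit[OF cs(2)]]])
      show "((\<lambda>l. X (i + int k) l / X (i + int k + 1) l * (solid_minor X (Suc k) (i - 1) (cs @ [l]) / X (i - 1 + int k + 1) l))
          \<longlongrightarrow> ?e * solid_minor (asw_step n X) k (i - 1) cs) at_top"
        by (intro tendsto_intros entry_ratio asw_step_minor_limit cs)
      show "\<forall>\<^sub>F l in at_top. c * (solid_minor X (Suc k) i (cs @ [l]) / X (i + int k + 1) l)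
         \<le> X (i + int k) l / X (i + int k + 1) l * (solid_minor X (Suc k) (i - 1) (cs @ [l]) / X (i - 1 + int k + 1) l)"
        using eventually_entry_pos[of "i + int k"] eventually_entry_pos[of "i + int k + 1"] eventually_int_list_less[of cs]
      proof eventually_elim
        case (elim l)
        then show ?case using c(2)[of "cs @ [l]"] cs
          by (simp add: sorted_wrt_append divide_right_mono)
      qed
    qed simp
    then show ?thesis using c(1) asw_eps_pos[of "i + int k"]
      by (intro exI[of _ "c / ?e"]) (auto simp: pos_divide_le_eq mult.commute)
  qed
qed

end

section \<open>The recursion for the limits\<close>

context solid_positive
begin

text \<open>Adding a far column \<open>l\<close> to the interval \<open>[h + 1..h + k]\<close> gives a set of columns between two
intervals of length \<open>k + 1\<close>: it arises from \<open>[h..h + k]\<close> by replacing \<open>h\<close> with \<open>l\<close>, and it becomes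
\<open>[l..l + k]\<close> by replacing the columns of \<open>[h + 1..h + k]\<close> from left to right. Letting first \<open>l\<close> and
then \<open>h\<close> tend to infinity squeezes the limit.\<close>

lemma minor_ratio_limit_step:
  assumes L: "((\<lambda>h. minor_ratio X (Suc k) i [h + 1..h + int (Suc k)]) \<longlongrightarrow> L) at_top"
    and L': "((\<lambda>h. minor_ratio (asw_step n X) k i [h + 1..h + int k]) \<longlongrightarrow> L') at_top"
  shows "L = asw_eps X (i + int k) * L'"
proof -
  interpret Y: solid_positive n "asw_step n X" by (rule solid_positive_asw_step)
  let ?R = "minor_ratio X (Suc k) i"
  obtain N where anti: "\<And>P p Q q. sorted_wrt (<) (P @ p # Q @ [q]) \<Longrightarrow> (\<forall>c\<in>set (P @ p # Q @ [q]). N \<le> c) \<Longrightarrow>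
     k = length (P @ Q) \<Longrightarrow> ?R (P @ Q @ [q]) \<le> ?R (P @ p # Q)"
    and pos: "\<And>cs. sorted_wrt (<) cs \<Longrightarrow> length cs = k \<Longrightarrow> (\<forall>c\<in>set cs. N \<le> c)
          \<Longrightarrow> 0 < solid_minor (asw_step n X) k i cs"
    using eventually_happens'[OF _ eventually_conj[OF eventually_minor_ratio_antimono[of "Suc k" i] Y.eventually_solid_minor_pos[of k i]]]
    by (metis trivial_limit_at_top_linorder)
  have upper_bound: "?R ([h + 1..h + int k] @ [l]) \<le> ?R [h - 1 + 1..h - 1 + int (Suc k)]"
    if "N \<le> h" "h + int k < l" for h l
  proof -
    have e: "[h - 1 + 1..h - 1 + int (Suc k)] = [] @ h # [h + 1..h + int k]"
      using upto_rec1[of h "h + int k"] by simp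
    show ?thesis unfolding e using anti[of "[]" h "[h + 1..h + int k]" l] that by (auto simp: sorted_wrt_append)
  qed
  have lower_bound: "?R [l - 1 + 1..l - 1 + int (Suc k)] \<le> ?R ([h + 1..h + int k] @ [l])"
    if "N \<le> h" "h + int k < l" for h l
  proof -
    have "?R ([h + 1 + int r..h + int k] @ [l..l + int r]) \<le> ?R ([h + 1..h + int k] @ [l])" if "r \<le> k" for r
      using that
    proof (induction r)
      case (Suc r)
      have e1: "[h + 1 + int r..h + int k] @ [l..l + int r]
          = [] @ (h + 1 + int r) # ([h + 1 + int (Suc r)..h + int k] @ [l..l + int r])"
        using upto_rec1[of "h + 1 + int r" "h + int k"] Suc.prems by (simp add: add_ac)
      have e2: "[h + 1 + int (Suc r)..h + int k] @ [l..l + int (Suc r)]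
          = [] @ ([h + 1 + int (Suc r)..h + int k] @ [l..l + int r]) @ [l + int (Suc r)]"
        using upto_rec2[of l "l + int (Suc r)"] by simp
      have "?R ([h + 1 + int (Suc r)..h + int k] @ [l..l + int (Suc r)]) \<le> ?R ([h + 1 + int r..h + int k] @ [l..l + int r])"
        unfolding e1 e2
        by (rule anti) (use \<open>N \<le> h\<close> \<open>h + int k < l\<close> Suc.prems in \<open>auto simp: sorted_wrt_append\<close>)
      with Suc show ?case by simp
    qed simp
    from this[of k] show ?thesis by simp
  qed
  define g where "g h = asw_eps X (i + int k) * minor_ratio (asw_step n X) k i [h + 1..h + int k]" for h
  have g: "((\<lambda>l. ?R ([h + 1..h + int k] @ [l])) \<longlongrightarrow> g h) at_top" if "N \<le> h" for h
    unfolding g_def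
    by (rule minor_ratio_last_column_limit) (use pos[of "[h + 1..h + int k]"] that in auto)
  have shifted: "((\<lambda>h. ?R [h - 1 + 1..h - 1 + int (Suc k)]) \<longlongrightarrow> L) at_top"
    using filterlim_compose[OF L filterlim_int_shift[of "-1"]] by simp
  have "L \<le> g h" if "N \<le> h" for h
  proof (rule tendsto_le[OF _ g[OF that] shifted])
    show "\<forall>\<^sub>F l in at_top. ?R [l - 1 + 1..l - 1 + int (Suc k)] \<le> ?R ([h + 1..h + int k] @ [l])"
      using eventually_gt_at_top[of "h + int k"] by eventually_elim (rule lower_bound[OF that])
  qed simp
  then have "\<forall>\<^sub>F h in at_top. L \<le> g h"
    unfolding eventually_at_top_linorder by blast
  moreover have "g h \<le> ?R [h - 1 + 1..h - 1 + int (Suc k)]" if "N \<le> h" for h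
  proof (rule tendsto_upperbound[OF g[OF that]])
    show "\<forall>\<^sub>F l in at_top. ?R ([h + 1..h + int k] @ [l]) \<le> ?R [h - 1 + 1..h - 1 + int (Suc k)]"
      using eventually_gt_at_top[of "h + int k"] by eventually_elim (rule upper_bound[OF that])
  qed simp
  then have "\<forall>\<^sub>F h in at_top. g h \<le> ?R [h - 1 + 1..h - 1 + int (Suc k)]"
    unfolding eventually_at_top_linorder by blast
  ultimately have "(g \<longlongrightarrow> L) at_top"
    by (rule tendsto_sandwich[OF _ _ tendsto_const shifted])
  moreover have "(g \<longlongrightarrow> asw_eps X (i + int k) * L') at_top"
    unfolding g_def by (intro tendsto_intros L')
  ultimately show ?thesis by (rule tendsto_unique[rotated]) simp
qed

end

lemma asw_matrix_step: "asw_matrix n (asw_step n X) m = asw_matrix n X (Suc m)"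
  by (induction m) simp_all

text \<open>Both limits acquire the same factor \<open>asw_eps X (i + k)\<close> when \<open>X\<close> replaces the next matrix of the
factorization, so their quotient is that of the next matrix with \<open>k\<close> lowered by one.\<close>

lemma minor_ratio_limit_asw_param:
  assumes "solid_positive n X"
    and "((\<lambda>h. minor_ratio X (Suc k) i [h + 1..h + int (Suc k)]) \<longlongrightarrow> L) at_top"
    and "((\<lambda>h. minor_ratio X k (i + 1) [h + 1..h + int k]) \<longlongrightarrow> L') at_top"
  shows "L = asw_param n X (Suc k) i * L'"
  using assms
proof (induction k arbitrary: X i L L')
  case 0
  interpret solid_positive n X by (rule 0)
  have one: "minor_ratio Y 0 j [] = 1" for Y j by (simp add: minor_ratio_def solid_minor_0)
  have "L' = 1" using 0(3) by (simp add: one tendsto_const_iff)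
  moreover have "L = asw_eps X (i + int 0) * 1"
    by (rule minor_ratio_limit_step[OF 0(2)]) (simp add: one)
  ultimately show ?case by (simp add: asw_param_def asw_eps_modidx)
next
  case (Suc k)
  interpret solid_positive n X by (rule Suc.prems(1))
  interpret Y: solid_positive n "asw_step n X" by (rule solid_positive_asw_step)
  obtain M where M: "((\<lambda>h. minor_ratio (asw_step n X) (Suc k) i [h + 1..h + int (Suc k)]) \<longlongrightarrow> M) at_top"
    using Y.minor_ratio_convergent by blast
  obtain M' where M': "((\<lambda>h. minor_ratio (asw_step n X) k (i + 1) [h + 1..h + int k]) \<longlongrightarrow> M') at_top"
    using Y.minor_ratio_convergent by blast
  have "L = asw_eps X (i + int (Suc k)) * M" by (rule minor_ratio_limit_step[OF Suc.prems(2) M])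
  moreover have "L' = asw_eps X (i + 1 + int k) * M'" by (rule minor_ratio_limit_step[OF Suc.prems(3) M'])
  moreover have "M = asw_param n (asw_step n X) (Suc k) i * M'"
    by (rule Suc.IH[OF Y.solid_positive_axioms M M'])
  moreover have "asw_param n (asw_step n X) (Suc k) i = asw_param n X (Suc (Suc k)) i"
    by (simp only: asw_param_def diff_Suc_1 asw_matrix_step)
  ultimately show ?case by (simp add: add_ac mult_ac)
qed

theorem corollary10p2:
  fixes n k :: nat and X :: zmat and i :: int
  assumes "n \<ge> 1" and "X \<in> RC n" and "k \<ge> 1"
  shows "\<exists>L1 L2.
      (\<forall>\<^sub>F h in at_top. zminor (seg k i) (seg k h) X \<noteq> 0) \<and>
      ((\<lambda>h::int. zminor (seg k (i - 1)) (seg k h) X / zminor (seg k i) (seg k h) X)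
         \<longlongrightarrow> L1) at_top \<and>
      (\<forall>\<^sub>F h in at_top. zminor (seg (k - 1) (i + 1)) (seg (k - 1) h) X \<noteq> 0) \<and>
      ((\<lambda>h::int. zminor (seg (k - 1) i) (seg (k - 1) h) X
                / zminor (seg (k - 1) (i + 1)) (seg (k - 1) h) X)
         \<longlongrightarrow> L2) at_top \<and>
      L2 \<noteq> 0 \<and>
      asw_param n X k i = L1 / L2"
proof -
  interpret solid_positive n X by (rule RC_solid_positive[OF assms(1,2)])
  have nonzero: "\<forall>\<^sub>F h in at_top. zminor (seg m j) (seg m h) X \<noteq> 0" for m j
    using eventually_solid_minor_pos[of m j] unfolding zminor_seg
  proof eventually_elim
    case (elim h)
    then show ?case using elim[rule_format, of "[h + 1..h + int m]"] by fastforce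
  qed
  obtain m where k: "k = Suc m" using assms(3) by (cases k) auto
  obtain L1 where L1: "((\<lambda>h. minor_ratio X (Suc m) i [h + 1..h + int (Suc m)]) \<longlongrightarrow> L1) at_top"
    using minor_ratio_convergent by blast
  obtain L2 where L2: "L2 > 0" "((\<lambda>h. minor_ratio X m (i + 1) [h + 1..h + int m]) \<longlongrightarrow> L2) at_top"
    using minor_ratio_convergent by blast
  have "L1 = asw_param n X k i * L2"
    unfolding k by (rule minor_ratio_limit_asw_param[OF solid_positive_axioms L1 L2(2)])
  then show ?thesis
    using nonzero[of k i] nonzero[of "k - 1" "i + 1"] L1 L2
    by (intro exI[of _ L1] exI[of _ L2]) (simp add: zminor_seg minor_ratio_def k)
qed

end
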